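(* Let $0<a<b<\infty$, let $p>1$ and $\alpha\in\left(\frac1p,1\right]$. Let $u\in AC[a,b]$ satisfy $u\in L^p(a,b)$, $u(a)=0$ and $\mathfrak{D}^{\alpha}_{a+}u\in L^p_{\frac1x}(a,b)$, where $\mathfrak{D}^{\alpha}_{a+}$ is the left Hadamard fractional derivative of order $\alpha$. Then $$\|u\|_{L^{\infty}(a,b)}\leq \frac{\left|\log\frac{b}{a}\right|^{\alpha-\frac{1}{p}}}{\left(\frac{\alpha p}{p-1}-\frac{1}{p-1}\right)^{\frac{p-1}{p}}\Gamma(\alpha)} \left\|\mathfrak{D}^{\alpha}_{a+}u\right\|_{L_{\frac{1}{x}}^p(a,b)}.$$
   Context: $AC[a,b]$ is the space of (real- or complex-valued) absolutely continuous functions on $[a,b]$, and $\Gamma$ is the Euler gamma function. For $0<\alpha<1$ and $f\in AC[a,b]$ the left Hadamard fractional derivative (of Caputo type) is $\mathfrak{D}_{a+}^{\alpha}f(t)=\frac{1}{\Gamma(1-\alpha)}\int_{a}^{t}\left(\log\frac{t}{s}\right)^{-\alpha}s f'(s)\,\frac{ds}{s}$ (for almost every $t\in(a,b]$), and for $\alpha=1$, $\mathfrak{D}_{a+}^1f(t)=t f'(t)$. For $p\ge1$, $\|v\|_{L^{p}_{\frac{1}{x}}(a,b)}=\left(\int_{a}^{b}|v(x)|^{p}\frac{dx}{x}\right)^{1/p}$, and $L^p_{\frac1x}(a,b)$ is the corresponding weighted Lebesgue space. *)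

theory Defs
  imports "HOL-Analysis.Analysis" "HOL-Probability.Essential_Supremum"
begin

(* The library's absolutely_continuous is a relation between measures; this is the
   epsilon-delta notion for functions, i.e. membership in AC[a,b]. *)
definition abs_cont_on :: "real \<Rightarrow> real \<Rightarrow> (real \<Rightarrow> 'a::real_normed_vector) \<Rightarrow> bool" where
  "abs_cont_on a b f \<longleftrightarrow>
    (\<forall>\<epsilon>>0. \<exists>\<delta>>0. \<forall>(n::nat) s t.
      (\<forall>i<n. a \<le> s i \<and> s i \<le> t i \<and> t i \<le> b) \<longrightarrow>
      disjoint_family_on (\<lambda>i. {s i<..<t i}) {..<n} \<longrightarrow>
      (\<Sum>i<n. t i - s i) < \<delta> \<longrightarrow>
      (\<Sum>i<n. norm (f (t i) - f (s i))) < \<epsilon>)"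

(* An AC function is differentiable almost everywhere. vector_derivative is unspecified on the
   exceptional null set, which need not be Borel; hence the completed measure lebesgue
   rather than lborel. *)
definition hadamard_deriv ::
    "real \<Rightarrow> real \<Rightarrow> (real \<Rightarrow> 'a::{banach, second_countable_topology}) \<Rightarrow> real \<Rightarrow> 'a" where
  "hadamard_deriv a \<alpha> f t =
    (if \<alpha> = 1 then t *\<^sub>R vector_derivative f (at t)
     else (1 / Gamma (1 - \<alpha>)) *\<^sub>R
       (LINT s:{a<..<t}|lebesgue.
          (ln (t / s) powr (- \<alpha>) / s) *\<^sub>R (s *\<^sub>R vector_derivative f (at s))))"

definition in_Lp :: "'b measure \<Rightarrow> real \<Rightarrow> ('b \<Rightarrow> 'a::real_normed_vector) \<Rightarrow> bool" where
  "in_Lp M p f \<longleftrightarrow> f \<in> borel_measurable M \<and> integrable M (\<lambda>x. norm (f x) powr p)"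

(* Only meaningful for functions satisfying in_Lp M p: otherwise the Bochner integral is 0. *)
definition Lp_norm :: "'b measure \<Rightarrow> real \<Rightarrow> ('b \<Rightarrow> 'a::real_normed_vector) \<Rightarrow> real" where
  "Lp_norm M p f = (\<integral>x. norm (f x) powr p \<partial>M) powr (1 / p)"

definition Linfty_norm :: "'b measure \<Rightarrow> ('b \<Rightarrow> 'a::real_normed_vector) \<Rightarrow> ereal" where
  "Linfty_norm M f = esssup M (\<lambda>x. ereal (norm (f x)))"

(* The measure dx/x on (a,b). *)
definition dx_over_x :: "real \<Rightarrow> real \<Rightarrow> real measure" where
  "dx_over_x a b = density (lebesgue_on {a<..<b}) (\<lambda>x. ennreal (1 / x))"

end

theory Submission
  imports Defs
begin

text \<open>An absolutely continuous \<open>u\<close> is the indefinite integral of its derivative. Exchanging the order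
  of integration and evaluating the inner Beta integral therefore inverts the Hadamard derivative:
  \<open>\<Gamma>(\<alpha>) u(t)\<close> is the integral of \<open>(ln (t / \<tau>)) powr (\<alpha> - 1)\<close> times the derivative of order \<open>\<alpha>\<close> over
  \<open>(a, t)\<close> with respect to \<open>d\<tau> / \<tau>\<close>. Hoelder's inequality gives the bound, the condition \<open>\<alpha> > 1 / p\<close>
  being what makes the power of the kernel integrable.

  Since the fundamental theorem of calculus for absolutely continuous functions is not in the library,
  it is obtained from the Radon-Nikodym theorem, applied to the Stieltjes measures of the positive
  variation of a real function \<open>f\<close> and of its difference with \<open>f\<close>, and from the Lebesgue differentiation
  theorem, which follows from Henstock's lemma and the Vitali covering theorem.\<close>

subsection \<open>Lebesgue differentiation\<close>

text \<open>The constant comes from one exponent. With \<open>q = p / (p - 1)\<close>, the kernel to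
  the power \<open>q\<close> is \<open>ln (t / \<tau>) powr (y - 1)\<close> for
  \<open>y = (\<alpha> - 1) * q + 1 = (\<alpha> * p - 1) / (p - 1)\<close>, and its integral against
  d\<tau> / \<tau> over (a, t) is \<open>ln (t / a) powr y / y\<close>. The power 1 / q turns this
  into the exponent \<open>y / q = \<alpha> - 1 / p\<close> over
  \<open>y powr ((p - 1) / p)\<close>; the factor \<open>Gamma \<alpha>\<close> is left over from
  the inversion. Two obstacles shape the rest. The derivative in \<open>hadamard_deriv\<close> is
  arbitrary on a null set, while Fubini is applied over \<open>lborel\<close>; so u' is replaced by
  a Borel density \<open>g\<close>, and the Hadamard derivative by a Borel function \<open>v\<close>
  equal to it almost everywhere. And a Stieltjes measure has a Lebesgue density only if its
  distribution function is absolutely continuous, so the positive variation must inherit this from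
  \<open>f\<close>; that transfer is the core of the variation part. Order 1 is separate: the
  singular kernel of order \<alpha> is not integrable there, and the derivative is a local
  expression.\<close>

text \<open>The segments between a bad point \<open>x\<close> and \<open>x + h\<close> cover the bad
  set in the sense of Vitali. Finitely many disjoint ones, each tagged at its endpoint
  \<open>x\<close>, form a partial division that is fine for the Henstock gauge, so their errors sum
  to less than \<open>e * k\<close>. Each error is at least \<open>k\<close> times the length, hence
  the lengths sum to at most \<open>e\<close>.\<close>

lemma negligible_henstock_bad_points:
  fixes f :: "real \<Rightarrow> 'a::euclidean_space"
  assumes f: "f integrable_on {a..b}" and k: "0 < k"
  defines "F \<equiv> \<lambda>x. integral {a..x} f"
  shows "negligible {x \<in> {a<..<b}. \<forall>d>0. \<exists>h. h \<noteq> 0 \<and> \<bar>h\<bar> < d \<and>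
    k * \<bar>h\<bar> \<le> norm (F (x + h) - F x - h *\<^sub>R f x)}" (is "negligible ?E")
  unfolding negligible_outer_le
proof (intro allI impI)
  fix e :: real assume e: "0 < e"
  have "0 < e * k" using e k by simp
  have "f integrable_on cbox a b" using f by simp
  then obtain \<gamma> where "gauge \<gamma>" and
    H: "\<And>p. p tagged_partial_division_of cbox a b \<Longrightarrow> \<gamma> fine p \<Longrightarrow>
          (\<Sum>(x,K)\<in>p. norm (measure lborel K *\<^sub>R f x - integral K f)) < e * k"
    by (rule Henstock_lemma[OF _ \<open>0 < e * k\<close>]) (rule that)
  \<comment> \<open>For either sign of \<open>h\<close> this is the closed segment between
    \<open>x\<close> and \<open>x + h\<close>, written as a ball about its midpoint because the
    covering theorem is about balls.\<close>
  define J :: "real \<times> real \<Rightarrow> real set" where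
    "J = (\<lambda>(x,h). cball (x + h/2) (\<bar>h\<bar>/2))"
  have J_eq: "J (x,h) = {min x (x + h)..max x (x + h)}" for x h
    unfolding J_def by (auto simp: cball_eq_atLeastAtMost min_def max_def field_simps)
  define I where "I = {(x,h). x \<in> ?E \<and> h \<noteq> 0 \<and> J (x,h) \<subseteq> \<gamma> x \<and> J (x,h) \<subseteq> {a..b} \<and>
    k * \<bar>h\<bar> \<le> norm (F (x + h) - F x - h *\<^sub>R f x)}"
  have cover: "\<exists>i. i \<in> I \<and> x \<in> cball (case i of (x,h) \<Rightarrow> x + h/2) (case i of (x,h) \<Rightarrow> \<bar>h\<bar>/2)
      \<and> (case i of (x,h) \<Rightarrow> \<bar>h\<bar>/2) < d" if x: "x \<in> ?E" and d: "0 < d" for x d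
  proof -
    have "open (\<gamma> x \<inter> {a<..<b})" "x \<in> \<gamma> x \<inter> {a<..<b}"
      using \<open>gauge \<gamma>\<close> x by (auto simp: gauge_def)
    then obtain r where r: "0 < r" "cball x r \<subseteq> \<gamma> x \<inter> {a<..<b}"
      using open_contains_cball by meson
    have "0 < min r d" using r d by simp
    then obtain h where h: "h \<noteq> 0" "\<bar>h\<bar> < min r d" "k * \<bar>h\<bar> \<le> norm (F (x + h) - F x - h *\<^sub>R f x)"
      using x by blast
    have "J (x,h) \<subseteq> cball x r"
      unfolding J_eq cball_eq_atLeastAtMost using h(2) by auto
    then have "J (x,h) \<subseteq> \<gamma> x" "J (x,h) \<subseteq> {a..b}"
      using r by force+
    then have "(x,h) \<in> I" unfolding I_def using x h by auto
    moreover have "x \<in> J (x,h)" unfolding J_eq by auto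
    ultimately show ?thesis using h d by (intro exI[of _ "(x,h)"]) (auto simp: J_def)
  qed
  have pos: "0 < (case i of (x,h) \<Rightarrow> \<bar>h\<bar>/2)" if "i \<in> I" for i
    using that by (auto simp: I_def)
  obtain C where C: "countable C" "C \<subseteq> I"
    and disj0: "pairwise (\<lambda>i j. disjnt (cball (case i of (x,h) \<Rightarrow> x + h/2) (case i of (x,h) \<Rightarrow> \<bar>h\<bar>/2))
         (cball (case j of (x,h) \<Rightarrow> x + h/2) (case j of (x,h) \<Rightarrow> \<bar>h\<bar>/2))) C"
    and neg0: "negligible (?E - (\<Union>i\<in>C. cball (case i of (x,h) \<Rightarrow> x + h/2) (case i of (x,h) \<Rightarrow> \<bar>h\<bar>/2)))"
    by (rule Vitali_covering_theorem_cballs[OF pos cover])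
  have J_alt: "cball (case i of (x,h) \<Rightarrow> x + h/2) (case i of (x,h) \<Rightarrow> \<bar>h\<bar>/2) = J i" for i
    by (auto simp: J_def split: prod.splits)
  note disj = disj0[unfolded J_alt] and neg = neg0[unfolded J_alt]
  have norm_eq: "norm (measure lborel (J (x,h)) *\<^sub>R f x - integral (J (x,h)) f)
      = norm (F (x + h) - F x - h *\<^sub>R f x)" if i: "(x,h) \<in> I" for x h
  proof -
    have sub: "J (x,h) \<subseteq> {a..b}" and ax: "a < x" "x < b" using i by (auto simp: I_def)
    then have xh: "a \<le> x + h" "x + h \<le> b"
      unfolding J_eq by (auto simp: min_def max_def split: if_splits)
    have comb: "F v - F u = integral {u..v} f" if "a \<le> u" "u \<le> v" "v \<le> b" for u v
    proof -
      have "f integrable_on {a..v}"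
        by (rule integrable_on_subinterval[OF f]) (use that in auto)
      with that show ?thesis
        unfolding F_def
        by (metis add_diff_cancel_left' Henstock_Kurzweil_Integration.integral_combine)
    qed
    show ?thesis
    proof (cases "0 \<le> h")
      case True
      then show ?thesis using comb[of x "x + h"] ax xh
        by (simp add: J_eq min_def max_def norm_minus_commute)
    next
      case False
      then have "integral (J (x,h)) f = F x - F (x + h)" "measure lborel (J (x,h)) = - h"
        using comb[of "x + h" x] ax xh by (auto simp: J_eq min_def max_def)
      then have "measure lborel (J (x,h)) *\<^sub>R f x - integral (J (x,h)) f = F (x + h) - F x - h *\<^sub>R f x"
        by simp
      then show ?thesis by simp
    qed
  qed
  have fin: "(\<Sum>i\<in>D. \<bar>snd i\<bar>) \<le> e" if D: "D \<subseteq> C" "finite D" for D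
  proof -
    let ?g = "\<lambda>i. (fst i, J i)"
    have ne: "J i \<noteq> {}" for i by (cases i) (auto simp: J_eq)
    \<comment> \<open>Henstock's lemma sums over the set of pairs (tag, cell). No term is lost,
      since two indices with the same nonempty cell would contradict disjointness.\<close>
    have inj: "inj_on ?g D"
    proof (rule inj_onI)
      fix i j assume "i \<in> D" "j \<in> D" "?g i = ?g j"
      then show "i = j"
        using disj D ne[of i] unfolding pairwise_def disjnt_def by (metis Int_absorb prod.inject subsetD)
    qed
    have "?g ` D tagged_partial_division_of cbox a b"
      unfolding tagged_partial_division_of_def
    proof (intro conjI allI impI)
      show "finite (?g ` D)" using D by simp
    next
      fix x K assume "(x,K) \<in> ?g ` D"
      then obtain h where h: "(x,h) \<in> D" "K = J (x,h)" by auto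
      then have "(x,h) \<in> I" using D C by auto
      with h show "x \<in> K" "K \<subseteq> cbox a b" "\<exists>a b. K = cbox a b"
        by (auto simp: I_def J_eq)
    next
      fix x1 K1 x2 K2 assume "(x1,K1) \<in> ?g ` D \<and> (x2,K2) \<in> ?g ` D \<and> (x1,K1) \<noteq> (x2,K2)"
      then obtain i j where ij: "i \<in> D" "j \<in> D" "K1 = J i" "K2 = J j" "i \<noteq> j" by auto
      then have "disjnt K1 K2" using disj D unfolding pairwise_def by blast
      then show "interior K1 \<inter> interior K2 = {}"
        by (meson disjnt_def disjoint_iff interior_subset subsetD)
    qed
    moreover have "\<gamma> fine ?g ` D"
      unfolding fine_def
    proof clarify
      fix i assume "i \<in> D"
      then have "(fst i, snd i) \<in> I" using D C by auto
      then show "x \<in> \<gamma> (fst i)" if "x \<in> J i" for x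
        using that by (auto simp: I_def simp del: mem_cball)
    qed
    ultimately have "(\<Sum>(x,K)\<in>?g ` D. norm (measure lborel K *\<^sub>R f x - integral K f)) < e * k"
      by (rule H)
    then have "(\<Sum>i\<in>D. norm (measure lborel (J i) *\<^sub>R f (fst i) - integral (J i) f)) < e * k"
      by (simp add: sum.reindex[OF inj])
    moreover have "(\<Sum>i\<in>D. k * \<bar>snd i\<bar>) \<le> (\<Sum>i\<in>D. norm (measure lborel (J i) *\<^sub>R f (fst i) - integral (J i) f))"
    proof (rule sum_mono)
      fix i assume "i \<in> D"
      then have "(fst i, snd i) \<in> I" using D C by auto
      from norm_eq[OF this] this show "k * \<bar>snd i\<bar> \<le> norm (measure lborel (J i) *\<^sub>R f (fst i) - integral (J i) f)"
        by (auto simp: I_def)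
    qed
    ultimately have "k * (\<Sum>i\<in>D. \<bar>snd i\<bar>) < k * e"
      by (simp add: sum_distrib_left mult.commute)
    then show ?thesis using k by simp
  qed
  have meas: "J i \<in> lmeasurable" "measure lebesgue (J i) = \<bar>snd i\<bar>" for i
    by (cases i; simp add: J_eq min_def max_def)+
  have bnd: "measure lebesgue (\<Union>i\<in>D. J i) \<le> e" if D: "D \<subseteq> C" "finite D" for D
  proof -
    have "measure lebesgue (\<Union>i\<in>D. J i) \<le> (\<Sum>i\<in>D. measure lebesgue (J i))"
      using D(2) meas(1) by (intro measure_UNION_le) (simp_all add: fmeasurableD)
    then show ?thesis using fin[OF D] by (simp only: meas)
  qed
  let ?T = "(\<Union>i\<in>C. J i) \<union> (?E - (\<Union>i\<in>C. J i))"
  have U: "(\<Union>i\<in>C. J i) \<in> lmeasurable" "measure lebesgue (\<Union>i\<in>C. J i) \<le> e"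
    using fmeasurable_UN_bound[OF C(1) meas(1) bnd] measure_UN_bound[OF C(1) meas(1) bnd] e by auto
  have N: "?E - (\<Union>i\<in>C. J i) \<in> null_sets lebesgue"
    using neg by (simp only: negligible_iff_null_sets)
  have "?T \<in> lmeasurable"
    by (rule fmeasurable.Un[OF U(1) fmeasurableI_null_sets[OF N]])
  moreover have "measure lebesgue ?T \<le> e"
    using U(2) by (simp only: measure_Un_null_set[OF fmeasurableD[OF U(1)] N])
  moreover have "?E \<subseteq> ?T"
    unfolding Un_Diff_cancel by (rule Un_upper2)
  ultimately show "\<exists>T. ?E \<subseteq> T \<and> T \<in> lmeasurable \<and> measure lebesgue T \<le> e"
    by (intro exI[of _ ?T] conjI)
qed

text \<open>If the derivative fails at \<open>x\<close>, the difference quotient misses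
  \<open>f x\<close> by a fixed amount for arbitrarily small \<open>h\<close>. That amount may be
  taken of the form \<open>1 / Suc n\<close>, which leaves countably many negligible sets.\<close>

theorem lebesgue_differentiation_integral:
  fixes f :: "real \<Rightarrow> 'a::euclidean_space"
  assumes f: "f integrable_on {a..b}"
  shows "negligible {x \<in> {a<..<b}. \<not> ((\<lambda>x. integral {a..x} f) has_vector_derivative f x) (at x)}"
    (is "negligible ?N")
proof -
  let ?F = "\<lambda>x. integral {a..x} f"
  let ?E = "\<lambda>k. {x \<in> {a<..<b}. \<forall>d>0. \<exists>h. h \<noteq> 0 \<and> \<bar>h\<bar> < d \<and>
    k * \<bar>h\<bar> \<le> norm (?F (x + h) - ?F x - h *\<^sub>R f x)}"
  have "?N \<subseteq> (\<Union>n. ?E (1 / Suc n))"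
  proof
    fix x assume x: "x \<in> ?N"
    show "x \<in> (\<Union>n. ?E (1 / Suc n))"
    proof (rule ccontr)
      assume c: "x \<notin> (\<Union>n. ?E (1 / Suc n))"
      have "(?F has_vector_derivative f x) (at x)"
        unfolding has_vector_derivative_def has_derivative_at_alt
      proof (intro conjI allI impI bounded_linear_scaleR_left)
        fix e :: real assume "0 < e"
        then obtain n where n: "1 / Suc n < e" using nat_approx_posE by blast
        from c x have "\<exists>d>0. \<forall>h. h \<noteq> 0 \<and> \<bar>h\<bar> < d \<longrightarrow>
          norm (?F (x + h) - ?F x - h *\<^sub>R f x) < 1 / Suc n * \<bar>h\<bar>"
          by (simp add: not_le) blast
        then obtain d where d: "d > 0" "\<And>h. h \<noteq> 0 \<Longrightarrow> \<bar>h\<bar> < d \<Longrightarrow>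
          norm (?F (x + h) - ?F x - h *\<^sub>R f x) < 1 / Suc n * \<bar>h\<bar>" by blast
        show "\<exists>d>0. \<forall>y. norm (y - x) < d \<longrightarrow>
          norm (?F y - ?F x - (y - x) *\<^sub>R f x) \<le> e * norm (y - x)"
        proof (intro exI[of _ d] conjI d allI impI)
          fix y assume y: "norm (y - x) < d"
          show "norm (?F y - ?F x - (y - x) *\<^sub>R f x) \<le> e * norm (y - x)"
          proof (cases "y = x")
            case False
            then have "norm (?F y - ?F x - (y - x) *\<^sub>R f x) < 1 / Suc n * \<bar>y - x\<bar>"
              using d(2)[of "y - x"] y by simp
            also have "\<dots> \<le> e * \<bar>y - x\<bar>" using n by (intro mult_right_mono) auto
            finally show ?thesis by simp
          qed simp
        qed
      qed
      then show False using x by simp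
    qed
  qed
  moreover have "negligible (?E (1 / Suc n))" for n
    by (rule negligible_henstock_bad_points[OF f]) simp
  then have "negligible (\<Union>n. ?E (1 / Suc n))"
    by (intro negligible_countable_Union) auto
  ultimately show ?thesis using negligible_subset by blast
qed

subsection \<open>Absolutely continuous functions\<close>

text \<open>Absolute continuity for one fixed pair (\<epsilon>, \<delta>). Naming the pair lets
  later lemmas say which \<delta> survives a construction.\<close>

definition variation_control :: "real \<Rightarrow> real \<Rightarrow> (real \<Rightarrow> 'a::real_normed_vector) \<Rightarrow> real \<Rightarrow> real \<Rightarrow> bool" where
  "variation_control a b f \<epsilon> \<delta> \<longleftrightarrow> (\<forall>(n::nat) s t.
      (\<forall>i<n. a \<le> s i \<and> s i \<le> t i \<and> t i \<le> b) \<longrightarrow>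
      disjoint_family_on (\<lambda>i. {s i<..<t i}) {..<n} \<longrightarrow>
      (\<Sum>i<n. t i - s i) < \<delta> \<longrightarrow>
      (\<Sum>i<n. norm (f (t i) - f (s i))) < \<epsilon>)"

lemma abs_cont_on_iff: "abs_cont_on a b f \<longleftrightarrow> (\<forall>\<epsilon>>0. \<exists>\<delta>>0. variation_control a b f \<epsilon> \<delta>)"
  unfolding abs_cont_on_def variation_control_def ..

text \<open>Allows any finite index set; below the intervals are indexed by pairs, by the cells of a
  covering, and by the unit type.\<close>

lemma variation_controlD:
  fixes I :: "'i set"
  assumes vc: "variation_control a b f \<epsilon> \<delta>" and "finite I"
    and st: "\<And>i. i \<in> I \<Longrightarrow> a \<le> s i \<and> s i \<le> t i \<and> t i \<le> b"
    and disj: "disjoint_family_on (\<lambda>i. {s i<..<t i}) I"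
    and len: "(\<Sum>i\<in>I. t i - s i) < \<delta>"
  shows "(\<Sum>i\<in>I. norm (f (t i) - f (s i))) < \<epsilon>"
proof -
  obtain h where h: "bij_betw h {..<card I} I"
    using ex_bij_betw_nat_finite[OF \<open>finite I\<close>] by (auto simp: atLeast0LessThan)
  have hI: "h i \<in> I" if "i < card I" for i
    using h that by (auto simp: bij_betw_def)
  have "disjoint_family_on (\<lambda>i. {s (h i)<..<t (h i)}) {..<card I}"
    unfolding disjoint_family_on_def
  proof (intro ballI impI)
    fix i j assume ij: "i \<in> {..<card I}" "j \<in> {..<card I}" "i \<noteq> j"
    then have "h i \<noteq> h j" using h by (metis bij_betw_def inj_on_def)
    then show "{s (h i)<..<t (h i)} \<inter> {s (h j)<..<t (h j)} = {}"
      using disj hI ij unfolding disjoint_family_on_def by blast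
  qed
  moreover have "(\<Sum>i<card I. t (h i) - s (h i)) < \<delta>"
    using len by (simp add: sum.reindex_bij_betw[OF h, of "\<lambda>i. t i - s i"])
  ultimately have "(\<Sum>i<card I. norm (f (t (h i)) - f (s (h i)))) < \<epsilon>"
    using vc[unfolded variation_control_def, rule_format, of "card I" "\<lambda>i. s (h i)" "\<lambda>i. t (h i)"] st hI
    by auto
  then show ?thesis
    by (simp add: sum.reindex_bij_betw[OF h, of "\<lambda>i. norm (f (t i) - f (s i))"])
qed

lemma sum_length_disjoint_le:
  fixes s t :: "'i \<Rightarrow> real"
  assumes "finite I" and st: "\<And>i. i \<in> I \<Longrightarrow> s i \<le> t i \<and> {s i<..<t i} \<subseteq> U"
    and disj: "disjoint_family_on (\<lambda>i. {s i<..<t i}) I"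
    and U: "U \<in> fmeasurable lborel"
  shows "(\<Sum>i\<in>I. t i - s i) \<le> measure lborel U"
proof -
  have "(\<Sum>i\<in>I. t i - s i) = (\<Sum>i\<in>I. measure lborel {s i<..<t i})"
    using st by (intro sum.cong) auto
  also have "\<dots> = measure lborel (\<Union>i\<in>I. {s i<..<t i})"
    using assms by (intro measure_finite_Union[symmetric]) (auto simp: emeasure_lborel_Ioo)
  also have "\<dots> \<le> measure lborel U"
    using st \<open>finite I\<close> by (intro measure_mono_fmeasurable U sets.finite_UN) auto
  finally show ?thesis .
qed

lemma sum_length_disjoint_Icc_le:
  fixes s t :: "'i \<Rightarrow> real"
  assumes "finite I" and st: "\<And>i. i \<in> I \<Longrightarrow> x \<le> s i \<and> s i \<le> t i \<and> t i \<le> y"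
    and disj: "disjoint_family_on (\<lambda>i. {s i<..<t i}) I" and "x \<le> y"
  shows "(\<Sum>i\<in>I. t i - s i) \<le> y - x"
proof -
  have "{s i<..<t i} \<subseteq> {x..y}" if "i \<in> I" for i
    using st[OF that] by auto
  moreover have "{x..y} \<in> fmeasurable lborel"
    by (intro fmeasurableI) (simp_all add: emeasure_lborel_Icc_eq)
  ultimately have "(\<Sum>i\<in>I. t i - s i) \<le> measure lborel {x..y}"
    using st \<open>finite I\<close> disj by (intro sum_length_disjoint_le) simp_all
  then show ?thesis using \<open>x \<le> y\<close> by simp
qed

lemma variation_control_comp_le:
  assumes "\<And>x y. a \<le> x \<Longrightarrow> x \<le> y \<Longrightarrow> y \<le> b \<Longrightarrow> norm (g y - g x) \<le> norm (f y - f x)"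
    and "variation_control a b f \<epsilon> \<delta>"
  shows "variation_control a b g \<epsilon> \<delta>"
  unfolding variation_control_def
proof (intro allI impI)
  fix n :: nat and s t
  assume *: "\<forall>i<n. a \<le> s i \<and> s i \<le> t i \<and> t i \<le> b"
    "disjoint_family_on (\<lambda>i. {s i<..<t i}) {..<n}" "(\<Sum>i<n. t i - s i) < \<delta>"
  have "(\<Sum>i<n. norm (g (t i) - g (s i))) \<le> (\<Sum>i<n. norm (f (t i) - f (s i)))"
    using assms(1) * by (intro sum_mono) auto
  also have "\<dots> < \<epsilon>" using assms(2) * unfolding variation_control_def by blast
  finally show "(\<Sum>i<n. norm (g (t i) - g (s i))) < \<epsilon>" .
qed

lemma abs_cont_on_diff:
  assumes "abs_cont_on a b f" "abs_cont_on a b g"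
  shows "abs_cont_on a b (\<lambda>x. f x - g x)"
  unfolding abs_cont_on_iff
proof (intro allI impI)
  fix \<epsilon> :: real assume "0 < \<epsilon>"
  then obtain d d' where d: "0 < d" "variation_control a b f (\<epsilon>/2) d"
    "0 < d'" "variation_control a b g (\<epsilon>/2) d'"
    using assms unfolding abs_cont_on_iff by (meson half_gt_zero)
  have "variation_control a b (\<lambda>x. f x - g x) \<epsilon> (min d d')"
    unfolding variation_control_def
  proof (intro allI impI)
    fix n :: nat and s t
    assume *: "\<forall>i<n. a \<le> s i \<and> s i \<le> t i \<and> t i \<le> b"
      "disjoint_family_on (\<lambda>i. {s i<..<t i}) {..<n}" "(\<Sum>i<n. t i - s i) < min d d'"
    have "(\<Sum>i<n. norm (f (t i) - g (t i) - (f (s i) - g (s i)))) \<le>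
      (\<Sum>i<n. norm (f (t i) - f (s i)) + norm (g (t i) - g (s i)))"
      by (intro sum_mono) norm
    also have "\<dots> = (\<Sum>i<n. norm (f (t i) - f (s i))) + (\<Sum>i<n. norm (g (t i) - g (s i)))"
      by (rule sum.distrib)
    also have "\<dots> < \<epsilon>/2 + \<epsilon>/2"
      using d * by (intro add_strict_mono) (auto simp: variation_control_def)
    finally show "(\<Sum>i<n. norm (f (t i) - g (t i) - (f (s i) - g (s i)))) < \<epsilon>" by simp
  qed
  then show "\<exists>\<delta>>0. variation_control a b (\<lambda>x. f x - g x) \<epsilon> \<delta>"
    using d by (intro exI[of _ "min d d'"]) auto
qed

section \<open>Positive variation of a real function\<close>

text \<open>The increments are signed and the intervals need not fill [x, y]. A family may thus skip
  the stretches where \<open>f\<close> decreases, which makes the supremum the positive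
  variation.\<close>

definition increment_sums :: "(real \<Rightarrow> real) \<Rightarrow> real \<Rightarrow> real \<Rightarrow> real set" where
  "increment_sums f x y = {\<Sum>i<n. f (t i) - f (s i) | (n::nat) s t.
      (\<forall>i<n. x \<le> s i \<and> s i \<le> t i \<and> t i \<le> y) \<and> disjoint_family_on (\<lambda>i. {s i<..<t i}) {..<n}}"

lemma increment_sumsI:
  assumes "\<forall>i<n. x \<le> s i \<and> s i \<le> t i \<and> t i \<le> y" "disjoint_family_on (\<lambda>i. {s i<..<t i}) {..<n::nat}"
  shows "(\<Sum>i<n. f (t i) - f (s i)) \<in> increment_sums f x y"
  unfolding increment_sums_def using assms by blast

lemma increment_sumsE:
  assumes "v \<in> increment_sums f x y"
  obtains n s t where "\<forall>i<n. x \<le> s i \<and> s i \<le> t i \<and> t i \<le> y"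
    "disjoint_family_on (\<lambda>i. {s i<..<t i}) {..<n::nat}" "v = (\<Sum>i<n. f (t i) - f (s i))"
  using assms unfolding increment_sums_def by blast

lemma zero_in_increment_sums: "0 \<in> increment_sums f x y"
  unfolding increment_sums_def by (rule CollectI, rule exI[of _ 0]) (simp add: disjoint_family_on_def)

lemma increment_sums_mono: "y \<le> z \<Longrightarrow> increment_sums f x y \<subseteq> increment_sums f x z"
proof
  fix v assume "y \<le> z" and v: "v \<in> increment_sums f x y"
  from v obtain n s t where "\<forall>i<n. x \<le> s i \<and> s i \<le> t i \<and> t i \<le> y"
    "disjoint_family_on (\<lambda>i. {s i<..<t i}) {..<n::nat}" "v = (\<Sum>i<n. f (t i) - f (s i))"
    by (rule increment_sumsE)
  moreover from this(1) \<open>y \<le> z\<close> have "\<forall>i<n. x \<le> s i \<and> s i \<le> t i \<and> t i \<le> z"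
    by (meson order_trans)
  ultimately show "v \<in> increment_sums f x z"
    by (simp only: increment_sumsI)
qed

lemma increment_sums_append:
  assumes v: "v \<in> increment_sums f x y" and "x \<le> y" "y \<le> z"
  shows "v + (f z - f y) \<in> increment_sums f x z"
proof -
  from v obtain n s t where *: "\<forall>i<n. x \<le> s i \<and> s i \<le> t i \<and> t i \<le> y"
    "disjoint_family_on (\<lambda>i. {s i<..<t i}) {..<n::nat}" "v = (\<Sum>i<n. f (t i) - f (s i))"
    by (rule increment_sumsE)
  let ?s = "s(n := y)" and ?t = "t(n := z)"
  have "\<forall>i<Suc n. x \<le> ?s i \<and> ?s i \<le> ?t i \<and> ?t i \<le> z"
    using * assms(2,3) by (fastforce simp: less_Suc_eq)
  moreover have "disjoint_family_on (\<lambda>i. {?s i<..<?t i}) {..<Suc n}"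
    using * unfolding disjoint_family_on_def by (fastforce simp: less_Suc_eq)
  moreover have "v + (f z - f y) = (\<Sum>i<Suc n. f (?t i) - f (?s i))"
    using * by simp
  ultimately show ?thesis by (simp only: increment_sumsI)
qed

text \<open>Every interval is cut at \<open>y\<close> by \<open>min\<close> and \<open>max\<close>.
  One lying on a single side leaves a degenerate interval with increment 0 on the other, so both
  halves keep the index range \<open>n\<close>.\<close>

lemma increment_sums_split:
  assumes v: "v \<in> increment_sums f x z" and "x \<le> y" "y \<le> z"
  shows "\<exists>v1\<in>increment_sums f x y. \<exists>v2\<in>increment_sums f y z. v = v1 + v2"
proof -
  from v obtain n s t where *: "\<forall>i<n. x \<le> s i \<and> s i \<le> t i \<and> t i \<le> z"
    "disjoint_family_on (\<lambda>i. {s i<..<t i}) {..<n::nat}" "v = (\<Sum>i<n. f (t i) - f (s i))"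
    by (rule increment_sumsE)
  have "disjoint_family_on (\<lambda>i. {min (s i) y<..<min (t i) y}) {..<n}"
    by (rule disjoint_family_on_bisimulation[OF *(2)]) auto
  moreover have "\<forall>i<n. x \<le> min (s i) y \<and> min (s i) y \<le> min (t i) y \<and> min (t i) y \<le> y"
    using * assms(2,3) by (auto simp: min_def)
  ultimately have 1: "(\<Sum>i<n. f (min (t i) y) - f (min (s i) y)) \<in> increment_sums f x y"
    by (rule increment_sumsI[rotated])
  have "disjoint_family_on (\<lambda>i. {max (s i) y<..<max (t i) y}) {..<n}"
    by (rule disjoint_family_on_bisimulation[OF *(2)]) auto
  moreover have "\<forall>i<n. y \<le> max (s i) y \<and> max (s i) y \<le> max (t i) y \<and> max (t i) y \<le> z"
    using * assms(2,3) by (auto simp: max_def)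
  ultimately have 2: "(\<Sum>i<n. f (max (t i) y) - f (max (s i) y)) \<in> increment_sums f y z"
    by (rule increment_sumsI[rotated])
  have "v = (\<Sum>i<n. f (min (t i) y) - f (min (s i) y)) + (\<Sum>i<n. f (max (t i) y) - f (max (s i) y))"
    unfolding *(3) sum.distrib[symmetric] using *(1) by (intro sum.cong) (auto simp: min_def max_def)
  with 1 2 show ?thesis by (intro bexI)
qed

lemma increment_sums_le_control:
  assumes vc: "variation_control a b f \<epsilon> \<delta>" and "a \<le> x" "x \<le> y" "y \<le> b" "y - x < \<delta>"
    and v: "v \<in> increment_sums f x y"
  shows "v \<le> \<epsilon>"
proof -
  from v obtain n s t where *: "\<forall>i<n. x \<le> s i \<and> s i \<le> t i \<and> t i \<le> y"
    "disjoint_family_on (\<lambda>i. {s i<..<t i}) {..<n::nat}" "v = (\<Sum>i<n. f (t i) - f (s i))"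
    by (rule increment_sumsE)
  have "(\<Sum>i<n. t i - s i) \<le> y - x"
    using * \<open>x \<le> y\<close> by (intro sum_length_disjoint_Icc_le) auto
  then have "(\<Sum>i<n. t i - s i) < \<delta>" using assms by simp
  then have "(\<Sum>i<n. norm (f (t i) - f (s i))) < \<epsilon>"
    using vc * assms(2,4) unfolding variation_control_def by (meson order_trans)
  moreover have "v \<le> (\<Sum>i<n. norm (f (t i) - f (s i)))"
    unfolding *(3) by (intro sum_mono) auto
  ultimately show ?thesis by simp
qed

text \<open>Take the \<delta> = \<open>d\<close> belonging to \<epsilon> = 1. Each piece of length
  at most \<open>d/2\<close> adds at most 1, and finitely many pieces exhaust the interval. Half of
  \<open>d\<close> is used because the control needs total length strictly below
  \<open>d\<close>.\<close>

lemma bdd_above_increment_sums: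
  assumes "abs_cont_on a b f" "a \<le> x" "x \<le> y" "y \<le> b"
  shows "bdd_above (increment_sums f x y)"
proof -
  obtain d where d: "0 < d" "variation_control a b f 1 d"
    using assms(1) unfolding abs_cont_on_iff by (metis zero_less_one)
  have "bdd_above (increment_sums f x y)" if "x \<le> y" "y \<le> b" "y - x \<le> real n * (d/2)" for n y
    using that
  proof (induction n arbitrary: y)
    case 0
    then show ?case
      using increment_sums_le_control[OF d(2), of x y] d(1) assms by (intro bdd_aboveI[of _ 1]) auto
  next
    case (Suc n)
    define m where "m = max x (y - d/2)"
    have m: "x \<le> m" "m \<le> y" "y - m < d" "m - x \<le> real n * (d/2)"
      using Suc.prems d(1) by (auto simp: m_def max_def field_simps)
    then have "bdd_above (increment_sums f x m)"
      using Suc.IH[of m] Suc.prems by auto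
    then obtain B where B: "\<And>v. v \<in> increment_sums f x m \<Longrightarrow> v \<le> B"
      by (auto simp: bdd_above_def)
    show ?case
    proof (rule bdd_aboveI)
      fix v assume "v \<in> increment_sums f x y"
      then obtain v1 v2 where v: "v1 \<in> increment_sums f x m" "v2 \<in> increment_sums f m y" "v = v1 + v2"
        using increment_sums_split m by blast
      have "v2 \<le> 1"
        by (rule increment_sums_le_control[OF d(2) _ _ _ _ v(2)]) (use m assms Suc.prems in auto)
      then show "v \<le> B + 1" using B[OF v(1)] v(3) by simp
    qed
  qed
  moreover obtain n where "(y - x) / (d/2) \<le> real n" using real_arch_simple by blast
  ultimately show ?thesis using assms d(1) by (auto simp: field_simps)
qed

definition pos_variation :: "real \<Rightarrow> (real \<Rightarrow> real) \<Rightarrow> real \<Rightarrow> real" where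
  "pos_variation a f x = Sup (increment_sums f a x)"

context
  fixes a b :: real and f :: "real \<Rightarrow> real"
  assumes ac: "abs_cont_on a b f"
begin

lemma pos_variation_mono:
  assumes "a \<le> x" "x \<le> y" "y \<le> b"
  shows "pos_variation a f x \<le> pos_variation a f y"
  unfolding pos_variation_def
  using zero_in_increment_sums[of f a x] increment_sums_mono[OF assms(2)] bdd_above_increment_sums[OF ac] assms
  by (intro cSup_subset_mono) auto

text \<open>Appending the interval [x, y] to a family in [a, x] adds \<open>f y - f x\<close> to its
  sum. Consequently the positive variation minus \<open>f\<close> is nondecreasing, the second half
  of the Jordan decomposition.\<close>

lemma pos_variation_ge_increment:
  assumes "a \<le> x" "x \<le> y" "y \<le> b"
  shows "f y - f x \<le> pos_variation a f y - pos_variation a f x"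
proof -
  have "pos_variation a f x \<le> pos_variation a f y - (f y - f x)"
    unfolding pos_variation_def
  proof (rule cSup_least)
    fix v assume "v \<in> increment_sums f a x"
    then have "v + (f y - f x) \<in> increment_sums f a y"
      by (rule increment_sums_append) (use assms in auto)
    then have "v + (f y - f x) \<le> Sup (increment_sums f a y)"
      by (rule cSup_upper) (use bdd_above_increment_sums[OF ac] assms in auto)
    then show "v \<le> Sup (increment_sums f a y) - (f y - f x)" by simp
  qed (use zero_in_increment_sums in blast)
  then show ?thesis by simp
qed

text \<open>Splitting at \<open>x\<close> shows that an increment of the positive variation is
  approximated from increments of \<open>f\<close> inside [x, y] alone.\<close>

lemma pos_variation_increment_le:
  assumes "a \<le> x" "x \<le> y" "y \<le> b"
  shows "pos_variation a f y - pos_variation a f x \<le> Sup (increment_sums f x y)"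
proof -
  have "pos_variation a f y \<le> pos_variation a f x + Sup (increment_sums f x y)"
    unfolding pos_variation_def
  proof (rule cSup_least)
    fix v assume "v \<in> increment_sums f a y"
    then obtain v1 v2 where v: "v1 \<in> increment_sums f a x" "v2 \<in> increment_sums f x y" "v = v1 + v2"
      using increment_sums_split assms by blast
    show "v \<le> Sup (increment_sums f a x) + Sup (increment_sums f x y)"
      unfolding v(3) using v assms bdd_above_increment_sums[OF ac] by (intro add_mono cSup_upper) auto
  qed (use zero_in_increment_sums in blast)
  then show ?thesis by simp
qed

text \<open>The same \<delta> works. Inside each given interval choose a finite family whose
  increment sum nearly reaches the increment of the positive variation. All these families together
  are still disjoint and no longer in total, so \<open>f\<close> changes by less than \<epsilon>
  over them; the approximation errors cost at most another \<epsilon>.\<close>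

lemma pos_variation_control:
  assumes vc: "variation_control a b f \<epsilon> \<delta>" and e: "0 < \<epsilon>"
  shows "variation_control a b (pos_variation a f) (2 * \<epsilon>) \<delta>"
  unfolding variation_control_def
proof (intro allI impI)
  fix n :: nat and x y :: "nat \<Rightarrow> real"
  assume xy: "\<forall>i<n. a \<le> x i \<and> x i \<le> y i \<and> y i \<le> b"
    and disj: "disjoint_family_on (\<lambda>i. {x i<..<y i}) {..<n}" and len: "(\<Sum>i<n. y i - x i) < \<delta>"
  \<comment> \<open>The error allowed per interval: \<open>n\<close> of them stay within \<epsilon>,
    and the added 1 covers \<open>n = 0\<close>.\<close>
  define \<eta> where "\<eta> = \<epsilon> / (real n + 1)"
  have "0 < \<eta>" using e by (simp add: \<eta>_def)
  \<comment> \<open>Here \<open>q\<close> packs the number of intervals and both endpoint sequences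
    into one triple, so that a single use of choice provides all three.\<close>
  have "\<forall>i\<in>{..<n}. \<exists>q. (\<forall>j<fst q. x i \<le> fst (snd q) j \<and> fst (snd q) j \<le> snd (snd q) j \<and> snd (snd q) j \<le> y i) \<and>
      disjoint_family_on (\<lambda>j. {fst (snd q) j<..<snd (snd q) j}) {..<fst q::nat} \<and>
      pos_variation a f (y i) - pos_variation a f (x i) - \<eta> \<le> (\<Sum>j<fst q. f (snd (snd q) j) - f (fst (snd q) j))"
  proof
    fix i assume "i \<in> {..<n}"
    then have i: "a \<le> x i" "x i \<le> y i" "y i \<le> b" using xy by auto
    have "pos_variation a f (y i) - pos_variation a f (x i) - \<eta> < Sup (increment_sums f (x i) (y i))"
      using pos_variation_increment_le[OF i] \<open>0 < \<eta>\<close> by simp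
    moreover have "increment_sums f (x i) (y i) \<noteq> {}"
      using zero_in_increment_sums by blast
    ultimately obtain v where v: "v \<in> increment_sums f (x i) (y i)"
      "pos_variation a f (y i) - pos_variation a f (x i) - \<eta> < v"
      by (meson less_cSupE)
    from v(1) obtain m s t where "\<forall>j<m. x i \<le> s j \<and> s j \<le> t j \<and> t j \<le> y i"
      "disjoint_family_on (\<lambda>j. {s j<..<t j}) {..<m::nat}" "v = (\<Sum>j<m. f (t j) - f (s j))"
      by (rule increment_sumsE)
    with v(2) show "\<exists>q. (\<forall>j<fst q. x i \<le> fst (snd q) j \<and> fst (snd q) j \<le> snd (snd q) j \<and> snd (snd q) j \<le> y i) \<and>
      disjoint_family_on (\<lambda>j. {fst (snd q) j<..<snd (snd q) j}) {..<fst q::nat} \<and>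
      pos_variation a f (y i) - pos_variation a f (x i) - \<eta> \<le> (\<Sum>j<fst q. f (snd (snd q) j) - f (fst (snd q) j))"
      by (intro exI[of _ "(m, s, t)"]) simp
  qed
  from bchoice[OF this] obtain q where q: "\<forall>i\<in>{..<n}. (\<forall>j<fst (q i). x i \<le> fst (snd (q i)) j \<and> fst (snd (q i)) j \<le> snd (snd (q i)) j \<and> snd (snd (q i)) j \<le> y i) \<and>
      disjoint_family_on (\<lambda>j. {fst (snd (q i)) j<..<snd (snd (q i)) j}) {..<fst (q i)::nat} \<and>
      pos_variation a f (y i) - pos_variation a f (x i) - \<eta> \<le> (\<Sum>j<fst (q i). f (snd (snd (q i)) j) - f (fst (snd (q i)) j))" ..
  define m s t where "m i = fst (q i)" and "s i = fst (snd (q i))" and "t i = snd (snd (q i))" for i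
  have st: "x i \<le> s i j \<and> s i j \<le> t i j \<and> t i j \<le> y i" if "i < n" "j < m i" for i j
    using q that by (simp add: m_def s_def t_def)
  have dj: "disjoint_family_on (\<lambda>j. {s i j<..<t i j}) {..<m i::nat}" if "i < n" for i
    using q that by (simp add: m_def s_def t_def)
  have ge: "pos_variation a f (y i) - pos_variation a f (x i) - \<eta> \<le> (\<Sum>j<m i. f (t i j) - f (s i j))" if "i < n" for i
    using q that by (simp add: m_def s_def t_def)
  let ?I = "SIGMA i:{..<n}. {..<m i}"
  have "(\<Sum>i\<in>?I. norm (f (case i of (i,j) \<Rightarrow> t i j) - f (case i of (i,j) \<Rightarrow> s i j))) < \<epsilon>"
  proof (rule variation_controlD[OF vc])
    show "a \<le> (case i of (i,j) \<Rightarrow> s i j) \<and> (case i of (i,j) \<Rightarrow> s i j) \<le> (case i of (i,j) \<Rightarrow> t i j) \<and>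
      (case i of (i,j) \<Rightarrow> t i j) \<le> b" if "i \<in> ?I" for i
      using that st xy by (fastforce intro: order_trans)
    show "disjoint_family_on (\<lambda>i. {case i of (i,j) \<Rightarrow> s i j<..<case i of (i,j) \<Rightarrow> t i j}) ?I"
      unfolding disjoint_family_on_def
    proof (intro ballI impI)
      fix p p' assume pp: "p \<in> ?I" "p' \<in> ?I" "p \<noteq> p'"
      obtain i j i' j' where p_eq: "p = (i, j)" "p' = (i', j')" by (meson surj_pair)
      have 1: "i < n" "j < m i" "i' < n" "j' < m i'" "(i, j) \<noteq> (i', j')" using pp p_eq by auto
      have "{s i j<..<t i j} \<inter> {s i' j'<..<t i' j'} = {}"
      proof (cases "i = i'")
        case True
        then show ?thesis using 1 dj[of i] unfolding disjoint_family_on_def by blast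
      next
        case False
        then have "{x i<..<y i} \<inter> {x i'<..<y i'} = {}"
          using disj 1 unfolding disjoint_family_on_def by blast
        moreover have "{s i j<..<t i j} \<subseteq> {x i<..<y i}" "{s i' j'<..<t i' j'} \<subseteq> {x i'<..<y i'}"
          using st[of i j] st[of i' j'] 1 by auto
        ultimately show ?thesis by blast
      qed
      then show "{case p of (i,j) \<Rightarrow> s i j<..<case p of (i,j) \<Rightarrow> t i j} \<inter>
        {case p' of (i,j) \<Rightarrow> s i j<..<case p' of (i,j) \<Rightarrow> t i j} = {}"
        by (simp only: p_eq prod.case)
    qed
    have "(\<Sum>i\<in>?I. (case i of (i,j) \<Rightarrow> t i j) - (case i of (i,j) \<Rightarrow> s i j)) = (\<Sum>i<n. \<Sum>j<m i. t i j - s i j)"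
      by (subst sum.Sigma) (auto intro!: sum.cong)
    also have "\<dots> \<le> (\<Sum>i<n. y i - x i)"
    proof (rule sum_mono)
      fix i assume "i \<in> {..<n}"
      then show "(\<Sum>j<m i. t i j - s i j) \<le> y i - x i"
        using st[of i] dj[of i] xy by (intro sum_length_disjoint_Icc_le) auto
    qed
    finally show "(\<Sum>i\<in>?I. (case i of (i,j) \<Rightarrow> t i j) - (case i of (i,j) \<Rightarrow> s i j)) < \<delta>"
      using len by simp
  qed auto
  also have "(\<Sum>i\<in>?I. norm (f (case i of (i,j) \<Rightarrow> t i j) - f (case i of (i,j) \<Rightarrow> s i j)))
      = (\<Sum>i<n. \<Sum>j<m i. norm (f (t i j) - f (s i j)))"
    by (subst sum.Sigma) (auto intro!: sum.cong)
  finally have small: "(\<Sum>i<n. \<Sum>j<m i. norm (f (t i j) - f (s i j))) < \<epsilon>" .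
  have "(\<Sum>i<n. norm (pos_variation a f (y i) - pos_variation a f (x i)))
     \<le> (\<Sum>i<n. (\<Sum>j<m i. norm (f (t i j) - f (s i j))) + \<eta>)"
  proof (rule sum_mono)
    fix i assume "i \<in> {..<n}"
    then have i: "i < n" "a \<le> x i" "x i \<le> y i" "y i \<le> b" using xy by auto
    have "(\<Sum>j<m i. f (t i j) - f (s i j)) \<le> (\<Sum>j<m i. norm (f (t i j) - f (s i j)))"
      by (intro sum_mono) auto
    then show "norm (pos_variation a f (y i) - pos_variation a f (x i)) \<le> (\<Sum>j<m i. norm (f (t i j) - f (s i j))) + \<eta>"
      using ge[OF i(1)] pos_variation_mono[OF i(2-)] by simp
  qed
  also have "\<dots> = (\<Sum>i<n. \<Sum>j<m i. norm (f (t i j) - f (s i j))) + real n * \<eta>"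
    by (simp add: sum.distrib)
  also have "real n * \<eta> \<le> \<epsilon>"
    using e by (simp add: \<eta>_def field_simps)
  finally show "(\<Sum>i<n. norm (pos_variation a f (y i) - pos_variation a f (x i))) < 2 * \<epsilon>"
    using small by simp
qed

lemma abs_cont_on_pos_variation: "abs_cont_on a b (pos_variation a f)"
  unfolding abs_cont_on_iff
proof (intro allI impI)
  fix \<epsilon> :: real assume "0 < \<epsilon>"
  then obtain d where "0 < d" "variation_control a b f (\<epsilon>/2) d"
    using ac unfolding abs_cont_on_iff by (meson half_gt_zero)
  then show "\<exists>\<delta>>0. variation_control a b (pos_variation a f) \<epsilon> \<delta>"
    using pos_variation_control[of "\<epsilon>/2" d] \<open>0 < \<epsilon>\<close> by auto
qed

end

section \<open>Stieltjes measures and their densities\<close>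

text \<open>A Lebesgue null set lies in an open \<open>U\<close> of measure below \<delta>.
  Countably many nonoverlapping intervals inside \<open>U\<close> cover it; any finitely many have
  total length below \<delta>, so \<open>G\<close> grows over them by less than \<open>e\<close>,
  and this bound passes to the countable union.\<close>

lemma mono_abs_cont_null:
  assumes "a < b" and mono: "\<And>x y. x \<le> y \<Longrightarrow> G x \<le> G y" and cont: "continuous_on UNIV G"
    and ac: "abs_cont_on a b G" and N: "N \<in> null_sets lborel" "N \<subseteq> {a..b}"
  shows "emeasure (interval_measure G) N = 0"
proof -
  let ?\<mu> = "interval_measure G"
  have Icc: "emeasure ?\<mu> {c..d} = ennreal (G d - G c)" if "c \<le> d" for c d
    by (rule emeasure_interval_measure_Icc[OF that mono cont])
  have le: "emeasure ?\<mu> N \<le> ennreal e" if "0 < e" for e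
  proof -
    obtain d where d: "0 < d" "variation_control a b G e d"
      using ac \<open>0 < e\<close> unfolding abs_cont_on_iff by blast
    obtain U where U: "open U" "N \<subseteq> U" "emeasure lborel (U - N) < ennreal d"
      by (rule outer_regular_lborel[OF _ d(1), of N]) (use N(1) in auto)
    have eU: "emeasure lborel U < ennreal d"
      using U emeasure_Diff_null_set[OF N(1), of U] by simp
    have mU: "U \<in> fmeasurable lborel" "measure lborel U < d"
      using eU U(1) d(1)
      by (auto intro!: fmeasurableI simp: measure_def enn2real_less_iff less_le_trans[OF _ top_greatest] order.strict_trans)
    \<comment> \<open>With this gauge each cell, whose tag lies in \<open>N\<close>, is forced into
      \<open>U\<close>. The value off \<open>N\<close> only has to be an open set containing the
      point.\<close>
    define g where "g x = (if x \<in> N then U else UNIV)" for x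
    have g: "gauge g" using U by (auto simp: g_def gauge_def)
    have ab: "N \<subseteq> cbox a b" "box a b \<noteq> {}" using N(2) \<open>a < b\<close> by auto
    obtain D where D: "countable D" "\<Union>D \<subseteq> cbox a b"
        "\<And>K. K \<in> D \<Longrightarrow> interior K \<noteq> {} \<and> (\<exists>c d. K = cbox c d)"
        "pairwise (\<lambda>A B. interior A \<inter> interior B = {}) D"
        "\<And>K. K \<in> D \<Longrightarrow> \<exists>x \<in> N \<inter> K. K \<subseteq> g x" "N \<subseteq> \<Union>D"
      by (rule covering_lemma[OF ab g]) (rule that)
    \<comment> \<open>Recovering the endpoints as \<open>Inf K\<close> and \<open>Sup K\<close> lets
      the cells index their own family of intervals.\<close>
    have K: "K = {Inf K..Sup K} \<and> Inf K < Sup K \<and> interior K = {Inf K<..<Sup K} \<and> K \<subseteq> U \<and> a \<le> Inf K \<and> Sup K \<le> b"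
      if KD: "K \<in> D" for K
    proof -
      obtain c d where cd: "K = {c..d}" using D(3)[OF KD] by auto
      then have "c < d" using D(3)[OF KD] by auto
      moreover have "K \<subseteq> U" using D(5)[OF KD] by (auto simp: g_def split: if_splits)
      moreover have "K \<subseteq> {a..b}" using D(2) KD by auto
      ultimately show ?thesis unfolding cd by simp
    qed
    have fin: "emeasure ?\<mu> (\<Union>D') \<le> ennreal e" if D': "D' \<subseteq> D" "finite D'" for D'
    proof -
      have KD': "K \<in> D" if "K \<in> D'" for K using D' that by blast
      have disj: "disjoint_family_on (\<lambda>K. {Inf K<..<Sup K}) D'"
        unfolding disjoint_family_on_def
      proof (intro ballI impI)
        fix A B assume "A \<in> D'" "B \<in> D'" "A \<noteq> B"
        then have "interior A \<inter> interior B = {}" using D(4) KD' by (simp add: pairwise_def)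
        then show "{Inf A<..<Sup A} \<inter> {Inf B<..<Sup B} = {}"
          using K[OF KD'[OF \<open>A \<in> D'\<close>]] K[OF KD'[OF \<open>B \<in> D'\<close>]] by simp
      qed
      have "(\<Sum>K\<in>D'. Sup K - Inf K) \<le> measure lborel U"
      proof (rule sum_length_disjoint_le[OF D'(2) _ disj mU(1)])
        fix K assume "K \<in> D'"
        from K[OF KD'[OF this]] show "Inf K \<le> Sup K \<and> {Inf K<..<Sup K} \<subseteq> U"
          by (metis interior_subset less_imp_le order_trans)
      qed
      then have *: "(\<Sum>K\<in>D'. norm (G (Sup K) - G (Inf K))) < e"
        using K[OF KD'] mU(2)
        by (intro variation_controlD[OF d(2) D'(2) _ disj]) (auto intro: less_imp_le)
      \<comment> \<open>Only the interiors of the cells are disjoint, so the bound goes through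
        subadditivity.\<close>
      have "emeasure ?\<mu> (\<Union>D') \<le> (\<Sum>K\<in>D'. emeasure ?\<mu> K)"
        using emeasure_subadditive_finite[OF D'(2), of id ?\<mu>] K[OF KD']
        by (metis (no_types, lifting) id_apply image_id image_subsetI sets_interval_measure atLeastAtMost_borel sum.cong)
      also have "\<dots> = (\<Sum>K\<in>D'. ennreal (norm (G (Sup K) - G (Inf K))))"
      proof (rule sum.cong[OF refl])
        fix K assume "K \<in> D'"
        note K' = K[OF KD'[OF this]]
        have "emeasure ?\<mu> K = emeasure ?\<mu> {Inf K..Sup K}" using K' by simp
        also have "\<dots> = ennreal (G (Sup K) - G (Inf K))" using K' by (intro Icc) simp
        also have "G (Sup K) - G (Inf K) = norm (G (Sup K) - G (Inf K))"
          using mono[of "Inf K" "Sup K"] K' by simp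
        finally show "emeasure ?\<mu> K = ennreal (norm (G (Sup K) - G (Inf K)))" .
      qed
      also have "\<dots> = ennreal (\<Sum>K\<in>D'. norm (G (Sup K) - G (Inf K)))"
        by (simp add: sum_ennreal)
      also have "\<dots> \<le> ennreal e" using * by (intro ennreal_leI) simp
      finally show ?thesis .
    qed
    have Kmeas: "K \<in> fmeasurable ?\<mu>" if "K \<in> D" for K
    proof -
      note K' = K[OF that]
      have "emeasure ?\<mu> {Inf K..Sup K} < \<infinity>" using K' by (subst Icc) simp_all
      then have "{Inf K..Sup K} \<in> fmeasurable ?\<mu>" by (intro fmeasurableI) simp_all
      then show ?thesis using K' by simp
    qed
    have mfin: "measure ?\<mu> (\<Union>K\<in>D'. K) \<le> e" if "D' \<subseteq> D" "finite D'" for D'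
      using fin[OF that] \<open>0 < e\<close> by (simp add: measure_def enn2real_leI)
    have UD: "(\<Union>K\<in>D. K) \<in> fmeasurable ?\<mu>" "measure ?\<mu> (\<Union>K\<in>D. K) \<le> e"
      using fmeasurable_UN_bound[OF D(1) Kmeas mfin] measure_UN_bound[OF D(1) Kmeas mfin] \<open>0 < e\<close> by auto
    have "emeasure ?\<mu> N \<le> emeasure ?\<mu> (\<Union>K\<in>D. K)"
      using D(6) UD(1) by (intro emeasure_mono) (auto dest: fmeasurableD)
    also have "\<dots> = ennreal (measure ?\<mu> (\<Union>K\<in>D. K))"
      by (rule emeasure_eq_measure2[OF UD(1)])
    also have "\<dots> \<le> ennreal e" using UD(2) by (rule ennreal_leI)
    finally show ?thesis .
  qed
  have "emeasure ?\<mu> N \<le> 0"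
    by (rule ennreal_le_epsilon) (use le in \<open>simp only: add_0_left\<close>)
  then show ?thesis by (simp only: le_zero_eq)
qed

lemma abs_cont_on_imp_continuous_on:
  fixes f :: "real \<Rightarrow> 'a::real_normed_vector"
  assumes "abs_cont_on a b f"
  shows "continuous_on {a..b} f"
  unfolding continuous_on_iff
proof (intro ballI allI impI)
  fix x \<epsilon> :: real assume x: "x \<in> {a..b}" and "0 < \<epsilon>"
  then obtain d where d: "0 < d" "variation_control a b f \<epsilon> d"
    using assms unfolding abs_cont_on_iff by blast
  have "dist (f y) (f x) < \<epsilon>" if y: "y \<in> {a..b}" "dist y x < d" for y
  proof -
    \<comment> \<open>Continuity is absolute continuity for a single interval.\<close>
    have "(\<Sum>i\<in>{()}. norm (f (max x y) - f (min x y))) < \<epsilon>"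
      by (rule variation_controlD[OF d(2)]) (use x y in \<open>auto simp: disjoint_family_on_def dist_real_def min_def max_def\<close>)
    then show ?thesis by (auto simp: dist_norm min_def max_def norm_minus_commute split: if_splits)
  qed
  then show "\<exists>d>0. \<forall>y\<in>{a..b}. dist y x < d \<longrightarrow> dist (f y) (f x) < \<epsilon>" using d(1) by blast
qed

lemma mono_abs_cont_integral_representation:
  fixes F :: "real \<Rightarrow> real"
  assumes "a < b" and ac: "abs_cont_on a b F"
    and mono: "\<And>x y. a \<le> x \<Longrightarrow> x \<le> y \<Longrightarrow> y \<le> b \<Longrightarrow> F x \<le> F y"
  shows "\<exists>g. integrable lborel g \<and> (\<forall>t\<in>{a..b}. F t - F a = (LINT x:{a..t}|lborel. g x))"
proof -
  \<comment> \<open>The extension of \<open>F\<close> by constants, since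
    \<open>interval_measure\<close> needs a distribution function monotone on the whole
    line.\<close>
  define G where "G x = F (max a (min x b))" for x
  have G_eq: "G x = F x" if "x \<in> {a..b}" for x using that by (simp add: G_def min_def max_def)
  have G_mono: "G x \<le> G y" if "x \<le> y" for x y
    unfolding G_def using that \<open>a < b\<close> by (intro mono) auto
  have "continuous_on UNIV (F \<circ> (\<lambda>x. max a (min x b)))"
    by (intro continuous_on_compose continuous_intros continuous_on_subset[OF abs_cont_on_imp_continuous_on[OF ac]])
       (use \<open>a < b\<close> in auto)
  then have G_cont: "continuous_on UNIV G" by (simp add: G_def[abs_def] comp_def)
  have G_ac: "abs_cont_on a b G"
    using ac variation_control_comp_le[of a b G F] unfolding abs_cont_on_iff
    by (metis G_eq atLeastAtMost_iff order_trans order_refl)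
  \<comment> \<open>Restricting the measure to (a, b] reduces its absolute continuity to null sets
    inside [a, b], the only ones covered by \<open>mono_abs_cont_null\<close>.\<close>
  define \<mu> where "\<mu> = density (interval_measure G) (indicator {a<..b})"
  have em: "emeasure \<mu> A = emeasure (interval_measure G) ({a<..b} \<inter> A)" if "A \<in> sets borel" for A
    unfolding \<mu>_def using that
    by (subst emeasure_density) (auto simp: indicator_inter_arith[symmetric])
  have "absolutely_continuous lborel \<mu>"
    unfolding absolutely_continuous_def
  proof
    fix N :: "real set" assume N: "N \<in> null_sets lborel"
    then have "{a<..b} \<inter> N \<in> null_sets lborel" by (intro null_set_Int1) auto
    then have "emeasure (interval_measure G) ({a<..b} \<inter> N) = 0"
      by (intro mono_abs_cont_null[OF \<open>a < b\<close> G_mono G_cont G_ac]) auto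
    then show "N \<in> null_sets \<mu>" using N em[of N] by (auto simp: null_sets_def \<mu>_def)
  qed
  moreover have "sets \<mu> = sets lborel" by (simp add: \<mu>_def)
  ultimately obtain h where h[measurable]: "h \<in> borel_measurable lborel" and h_eq: "density lborel h = \<mu>"
    using sigma_finite_measure.Radon_Nikodym[OF sigma_finite_lborel] by blast
  have h_int: "(\<integral>\<^sup>+x. h x * indicator A x \<partial>lborel) = emeasure (interval_measure G) ({a<..b} \<inter> A)"
    if "A \<in> sets borel" for A
    using that em[OF that] unfolding h_eq[symmetric] by (subst (asm) emeasure_density) auto
  have Ioc: "emeasure (interval_measure G) {c<..d} = ennreal (G d - G c)" if "c \<le> d" for c d
    using G_cont that
    by (intro emeasure_interval_measure_Ioc G_mono) (auto intro: continuous_within_subset simp: continuous_on_eq_continuous_within)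
  have "(\<integral>\<^sup>+x. h x \<partial>lborel) = ennreal (G b - G a)"
    using h_int[of UNIV] Ioc[of a b] \<open>a < b\<close> by simp
  then have fin: "(\<integral>\<^sup>+x. h x \<partial>lborel) \<noteq> \<infinity>" by simp
  then have AE_h: "AE x in lborel. h x \<noteq> \<infinity>" by (intro nn_integral_PInf_AE) auto
  \<comment> \<open>The total mass \<open>G b - G a\<close> is finite, so the Radon-Nikodym density
    \<open>h\<close> is infinite only on a null set, where \<open>enn2real\<close> substitutes
    0.\<close>
  define g where "g x = enn2real (h x)" for x
  have g_eq: "AE x in lborel. ennreal (g x) = h x"
    using AE_h by eventually_elim (simp add: g_def less_top)
  have [measurable]: "g \<in> borel_measurable lborel" unfolding g_def by simp
  have g_nn: "0 \<le> g x" for x by (simp add: g_def)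
  have "integrable lborel g"
  proof (rule integrableI_nonneg)
    have "(\<integral>\<^sup>+x. ennreal (g x) \<partial>lborel) = (\<integral>\<^sup>+x. h x \<partial>lborel)"
      by (intro nn_integral_cong_AE g_eq)
    then show "(\<integral>\<^sup>+x. ennreal (g x) \<partial>lborel) < \<infinity>" using fin by (simp add: less_top)
  qed (use g_nn in auto)
  moreover have "F t - F a = (LINT x:{a..t}|lborel. g x)" if t: "t \<in> {a..b}" for t
  proof -
    have "(LINT x:{a..t}|lborel. g x) = enn2real (\<integral>\<^sup>+x. ennreal (indicator {a..t} x *\<^sub>R g x) \<partial>lborel)"
      unfolding set_lebesgue_integral_def by (intro integral_eq_nn_integral) (auto simp: g_nn)
    also have "(\<integral>\<^sup>+x. ennreal (indicator {a..t} x *\<^sub>R g x) \<partial>lborel) = (\<integral>\<^sup>+x. h x * indicator {a..t} x \<partial>lborel)"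
      using g_eq by (intro nn_integral_cong_AE) (auto split: split_indicator)
    also have "\<dots> = emeasure (interval_measure G) ({a<..b} \<inter> {a..t})" by (rule h_int) simp
    also have "{a<..b} \<inter> {a..t} = {a<..t}" using t by auto
    also have "emeasure (interval_measure G) {a<..t} = ennreal (G t - G a)" using t by (intro Ioc) auto
    finally show ?thesis using t G_mono[of a t] by (simp add: G_eq)
  qed
  ultimately show ?thesis by blast
qed

text \<open>With \<open>P\<close> the positive variation, f = P - (P - f) is a difference of two
  nondecreasing absolutely continuous functions, so the two densities are subtracted.\<close>

lemma real_abs_cont_integral_representation:
  fixes f :: "real \<Rightarrow> real"
  assumes "a < b" and ac: "abs_cont_on a b f"
  shows "\<exists>g. integrable lborel g \<and> (\<forall>t\<in>{a..b}. f t - f a = (LINT x:{a..t}|lborel. g x))"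
proof -
  let ?P = "pos_variation a f"
  have acP: "abs_cont_on a b ?P" by (rule abs_cont_on_pos_variation[OF ac])
  obtain g where g: "integrable lborel g" "\<And>t. t \<in> {a..b} \<Longrightarrow> ?P t - ?P a = (LINT x:{a..t}|lborel. g x)"
    using mono_abs_cont_integral_representation[OF \<open>a < b\<close> acP pos_variation_mono[OF ac]] by blast
  have "\<exists>g. integrable lborel g \<and> (\<forall>t\<in>{a..b}. (?P t - f t) - (?P a - f a) = (LINT x:{a..t}|lborel. g x))"
    by (rule mono_abs_cont_integral_representation[OF \<open>a < b\<close> abs_cont_on_diff[OF acP ac]])
       (use pos_variation_ge_increment[OF ac] in fastforce)
  then obtain g' where g': "integrable lborel g'"
    "\<And>t. t \<in> {a..b} \<Longrightarrow> (?P t - f t) - (?P a - f a) = (LINT x:{a..t}|lborel. g' x)" by blast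
  have si: "set_integrable lborel {a..t} g" "set_integrable lborel {a..t} g'" for t
    unfolding set_integrable_def by (intro integrable_mult_indicator g(1) g'(1); simp)+
  have "f t - f a = (LINT x:{a..t}|lborel. g x - g' x)" if "t \<in> {a..b}" for t
    using g(2)[OF that] g'(2)[OF that] by (simp add: set_integral_diff(2)[OF si])
  then show ?thesis using g(1) g'(1) by (intro exI[of _ "\<lambda>x. g x - g' x"]) auto
qed

section \<open>Fundamental theorem of calculus for absolutely continuous functions\<close>

text \<open>The densities of the coordinate functions are assembled into one vector-valued
  \<open>g\<close>. Differentiating the indefinite integral of \<open>g\<close> then identifies
  \<open>g\<close> with the derivative of \<open>f\<close> almost everywhere.\<close>

theorem abs_cont_integral_representation:
  fixes f :: "real \<Rightarrow> 'a::euclidean_space"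
  assumes "a < b" and ac: "abs_cont_on a b f"
  obtains g where "integrable lborel g" "\<And>t. t \<in> {a..b} \<Longrightarrow> f t - f a = (LINT x:{a..t}|lborel. g x)"
    "AE x in lborel. x \<in> {a<..<b} \<longrightarrow> (f has_vector_derivative g x) (at x)"
proof -
  have "\<exists>g. integrable lborel g \<and> (\<forall>t\<in>{a..b}. f t \<bullet> i - f a \<bullet> i = (LINT x:{a..t}|lborel. g x))"
    if "i \<in> Basis" for i
  proof (rule real_abs_cont_integral_representation[OF \<open>a < b\<close>])
    have "norm (f y \<bullet> i - f x \<bullet> i) \<le> norm (f y - f x)" for x y
      unfolding inner_diff_left[symmetric] using Basis_le_norm[OF that] by simp
    then show "abs_cont_on a b (\<lambda>t. f t \<bullet> i)"
      using ac variation_control_comp_le[of a b "\<lambda>t. f t \<bullet> i" f] unfolding abs_cont_on_iff by blast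
  qed
  then have "\<forall>i\<in>Basis. \<exists>g. integrable lborel g \<and> (\<forall>t\<in>{a..b}. f t \<bullet> i - f a \<bullet> i = (LINT x:{a..t}|lborel. g x))"
    by blast
  from bchoice[OF this] obtain G where
    G: "\<forall>i\<in>Basis. integrable lborel (G i) \<and> (\<forall>t\<in>{a..b}. f t \<bullet> i - f a \<bullet> i = (LINT x:{a..t}|lborel. G i x))" ..
  define g where "g x = (\<Sum>i\<in>Basis. G i x *\<^sub>R i)" for x
  have int: "integrable lborel g"
    unfolding g_def using G by (intro Bochner_Integration.integrable_sum integrable_scaleR_left) auto
  have rep: "f t - f a = (LINT x:{a..t}|lborel. g x)" if t: "t \<in> {a..b}" for t
  proof -
    have si: "set_integrable lborel {a..t} (G i)" if "i \<in> Basis" for i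
      using G that unfolding set_integrable_def by (intro integrable_mult_indicator) simp_all
    have "(LINT x:{a..t}|lborel. g x) = (\<Sum>i\<in>Basis. (LINT x:{a..t}|lborel. G i x *\<^sub>R i))"
      unfolding g_def set_lebesgue_integral_def scaleR_sum_right
      by (rule Bochner_Integration.integral_sum)
         (use si in \<open>auto simp: set_integrable_def intro: integrable_scaleR_left\<close>)
    also have "\<dots> = (\<Sum>i\<in>Basis. ((f t - f a) \<bullet> i) *\<^sub>R i)"
    proof (rule sum.cong[OF refl])
      fix i :: 'a assume i: "i \<in> Basis"
      have "(LINT x:{a..t}|lborel. G i x *\<^sub>R i) = (LINT x:{a..t}|lborel. G i x) *\<^sub>R i"
        using si[OF i] unfolding set_lebesgue_integral_def set_integrable_def
        by (subst integral_scaleR_left[symmetric]) auto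
      then show "(LINT x:{a..t}|lborel. G i x *\<^sub>R i) = ((f t - f a) \<bullet> i) *\<^sub>R i"
        using G i t by (simp add: inner_diff_left)
    qed
    finally show ?thesis by (simp add: euclidean_representation)
  qed
  have si: "set_integrable lborel {a..t} g" for t
    using int unfolding set_integrable_def by (intro integrable_mult_indicator) simp_all
  have ri: "f t - f a = integral {a..t} g" if "t \<in> {a..b}" for t
    using rep[OF that] set_borel_integral_eq_integral(2)[OF si] by simp
  have "negligible {x \<in> {a<..<b}. \<not> ((\<lambda>x. integral {a..x} g) has_vector_derivative g x) (at x)}"
    by (rule lebesgue_differentiation_integral set_borel_integral_eq_integral(1)[OF si])+
  then have "AE x in lebesgue. x \<notin> {x \<in> {a<..<b}. \<not> ((\<lambda>x. integral {a..x} g) has_vector_derivative g x) (at x)}"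
    unfolding negligible_iff_null_sets by (rule AE_not_in)
  then have "AE x in lborel. x \<notin> {x \<in> {a<..<b}. \<not> ((\<lambda>x. integral {a..x} g) has_vector_derivative g x) (at x)}"
    by (simp only: AE_completion_iff)
  then have "AE x in lborel. x \<in> {a<..<b} \<longrightarrow> (f has_vector_derivative g x) (at x)"
  proof eventually_elim
    case (elim x)
    show ?case
    proof
      assume x: "x \<in> {a<..<b}"
      then have "((\<lambda>x. f a + integral {a..x} g) has_vector_derivative g x) (at x)"
        using elim by (auto intro!: derivative_eq_intros)
      then show "(f has_vector_derivative g x) (at x)"
        by (rule has_vector_derivative_transform_within_open[of _ _ _ "{a<..<b}"])
           (use x in \<open>auto simp: ri[symmetric]\<close>)
    qed
  qed
  with int rep show thesis by (rule that)
qed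

subsection \<open>Hoelder's inequality and logarithmic kernels\<close>

lemma powr_integral_eq_0_imp_AE:
  fixes f :: "'b \<Rightarrow> real"
  assumes "integrable M (\<lambda>x. \<bar>f x\<bar> powr p)" "(\<integral>x. \<bar>f x\<bar> powr p \<partial>M) = 0"
  shows "AE x in M. f x = 0"
proof -
  have "AE x in M. \<bar>f x\<bar> powr p = 0"
    using integral_nonneg_eq_0_iff_AE[OF assms(1)] assms(2) by simp
  then show ?thesis by eventually_elim simp
qed

text \<open>Young's inequality is applied pointwise after dividing each factor by its norm;
  integrating gives 1 / p + 1 / q = 1.\<close>

lemma Holder_inequality:
  fixes f g :: "'b \<Rightarrow> real"
  assumes pq: "1 < p" "1 < q" "1 / p + 1 / q = 1"
    and [measurable]: "f \<in> borel_measurable M" "g \<in> borel_measurable M"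
    and f: "integrable M (\<lambda>x. \<bar>f x\<bar> powr p)" and g: "integrable M (\<lambda>x. \<bar>g x\<bar> powr q)"
  shows "integrable M (\<lambda>x. f x * g x)"
    and "(\<integral>x. \<bar>f x * g x\<bar> \<partial>M) \<le> (\<integral>x. \<bar>f x\<bar> powr p \<partial>M) powr (1 / p) * (\<integral>x. \<bar>g x\<bar> powr q \<partial>M) powr (1 / q)"
proof -
  have Young: "\<bar>x * y\<bar> \<le> \<bar>x\<bar> powr p / p + \<bar>y\<bar> powr q / q" for x y :: real
    using Youngs_inequality[OF pq, of "\<bar>x\<bar>" "\<bar>y\<bar>"] by (simp add: abs_mult)
  show int: "integrable M (\<lambda>x. f x * g x)"
  proof (rule Bochner_Integration.integrable_bound)
    show "integrable M (\<lambda>x. \<bar>f x\<bar> powr p / p + \<bar>g x\<bar> powr q / q)" using f g by simp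
    show "AE x in M. norm (f x * g x) \<le> norm (\<bar>f x\<bar> powr p / p + \<bar>g x\<bar> powr q / q)"
      by (rule AE_I2) (use Young in \<open>metis abs_ge_self order_trans real_norm_def\<close>)
  qed simp
  define A where "A = (\<integral>x. \<bar>f x\<bar> powr p \<partial>M)"
  define B where "B = (\<integral>x. \<bar>g x\<bar> powr q \<partial>M)"
  have AB: "0 \<le> A" "0 \<le> B" by (simp_all add: A_def B_def)
  show "(\<integral>x. \<bar>f x * g x\<bar> \<partial>M) \<le> A powr (1 / p) * B powr (1 / q)"
  \<comment> \<open>The normalisation divides by both norms. If one vanishes, that factor is 0
    almost everywhere and so is the product.\<close>
  proof (cases "A = 0 \<or> B = 0")
    case True
    then have "(AE x in M. f x = 0) \<or> (AE x in M. g x = 0)"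
      using powr_integral_eq_0_imp_AE[OF f] powr_integral_eq_0_imp_AE[OF g] by (auto simp: A_def B_def)
    then have "AE x in M. \<bar>f x * g x\<bar> = 0" by (elim disjE; elim AE_mp; simp)
    then have "(\<integral>x. \<bar>f x * g x\<bar> \<partial>M) = 0" by (rule integral_eq_zero_AE)
    then show ?thesis by simp
  next
    case False
    with AB have pos: "0 < A" "0 < B" by auto
    define c where "c = A powr (1 / p) * B powr (1 / q)"
    have "0 < c" using pos by (simp add: c_def)
    have pt: "\<bar>f x * g x\<bar> / c \<le> \<bar>f x\<bar> powr p / (p * A) + \<bar>g x\<bar> powr q / (q * B)" for x
    proof -
      have "\<bar>f x * g x\<bar> / c = \<bar>(f x / A powr (1/p)) * (g x / B powr (1/q))\<bar>"
        using \<open>0 < c\<close> by (simp add: c_def abs_mult)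
      also have "\<dots> \<le> \<bar>f x / A powr (1/p)\<bar> powr p / p + \<bar>g x / B powr (1/q)\<bar> powr q / q" by (rule Young)
      also have "\<bar>f x / A powr (1/p)\<bar> powr p = \<bar>f x\<bar> powr p / A"
        using pos pq by (simp add: powr_divide powr_powr)
      also have "\<bar>g x / B powr (1/q)\<bar> powr q = \<bar>g x\<bar> powr q / B"
        using pos pq by (simp add: powr_divide powr_powr)
      finally show ?thesis by (simp add: mult.commute)
    qed
    have "(\<integral>x. \<bar>f x * g x\<bar> / c \<partial>M) \<le> (\<integral>x. \<bar>f x\<bar> powr p / (p * A) + \<bar>g x\<bar> powr q / (q * B) \<partial>M)"
      using int f g pt by (intro integral_mono) auto
    also have "\<dots> = 1 / p + 1 / q"
      using f g pos by (simp add: A_def[symmetric] B_def[symmetric])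
    also have "\<dots> = 1" by (rule pq)
    finally show ?thesis using \<open>0 < c\<close> by (simp add: c_def[symmetric] field_simps)
  qed
qed

section \<open>Beta integrals in logarithmic form\<close>

lemma nn_integral_Beta_real:
  assumes "x > 0" "y > (0::real)"
  shows "(\<integral>\<^sup>+t. ennreal (t powr (x - 1) * (1 - t) powr (y - 1)) * indicator {0..1} t \<partial>lborel) = ennreal (Beta x y)"
proof -
  have "(\<integral>\<^sup>+t. ennreal (indicator {0..1} t * (t powr (x - 1) * (1 - t) powr (y - 1))) \<partial>lborel) = ennreal (Beta x y)"
    by (rule nn_integral_has_integral_lebesgue[OF _ has_integral_Beta_real[OF assms]]) simp
  then show ?thesis by (simp add: ennreal_mult'' mult.commute ennreal_indicator)
qed

text \<open>The substitution \<open>u = ln (\<tau> / s) / L\<close> with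
  \<open>L = ln (t / s)\<close> maps [s, t] onto [0, 1]; the logarithms become \<open>L * u\<close>
  and \<open>L * (1 - u)\<close>, and d\<tau> / \<tau> becomes \<open>L\<close> du. Collecting
  powers of \<open>L\<close> gives the exponent (x - 1) + (y - 1) + 1. Working with nonnegative
  integrals avoids a prior integrability proof at the singular endpoints.\<close>

lemma nn_integral_log_kernel:
  fixes s t x y :: real
  assumes "0 < s" "s < t" "0 < x" "0 < y"
  shows "(\<integral>\<^sup>+\<tau>. ennreal (indicator {s<..<t} \<tau> * (ln (\<tau> / s) powr (x - 1) * ln (t / \<tau>) powr (y - 1) / \<tau>)) \<partial>lborel)
    = ennreal (ln (t / s) powr (x + y - 1) * Beta x y)"
proof -
  define L where "L = ln (t / s)"
  have L: "0 < L" using assms by (simp add: L_def)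
  define g where "g = (\<lambda>\<tau>. ln (\<tau> / s) / L)"
  define f where "f = (\<lambda>u::real. ennreal (u powr (x - 1) * (1 - u) powr (y - 1)))"
  have g01: "g s = 0" "g t = 1" using assms L by (simp_all add: g_def L_def)
  have "(\<integral>\<^sup>+u. f u * indicator {g s..g t} u \<partial>lborel)
      = (\<integral>\<^sup>+\<tau>. f (g \<tau>) * ennreal (1 / (\<tau> * L)) * indicator {s..t} \<tau> \<partial>lborel)"
  proof (rule nn_integral_substitution_aux)
    show "f \<in> borel_measurable borel" unfolding f_def by measurable
    show "(g has_real_derivative 1 / (\<tau> * L)) (at \<tau>)" if "\<tau> \<in> {s..t}" for \<tau>
      unfolding g_def using that assms L by (auto intro!: derivative_eq_intros simp: field_simps)
    show "continuous_on {s..t} (\<lambda>\<tau>. 1 / (\<tau> * L))"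
      using assms L by (auto intro!: continuous_intros)
  qed (use assms L in auto)
  then have Beta_eq: "(\<integral>\<^sup>+\<tau>. f (g \<tau>) * ennreal (1 / (\<tau> * L)) * indicator {s..t} \<tau> \<partial>lborel) = ennreal (Beta x y)"
    using nn_integral_Beta_real[OF assms(3,4)] by (simp add: g01 f_def)
  have pt: "ln (\<tau> / s) powr (x - 1) * ln (t / \<tau>) powr (y - 1) / \<tau>
      = L powr (x + y - 1) * (g \<tau> powr (x - 1) * (1 - g \<tau>) powr (y - 1) * (1 / (\<tau> * L)))"
    if \<tau>: "\<tau> \<in> {s<..<t}" for \<tau>
  proof -
    have g: "0 \<le> g \<tau>" using \<tau> assms L by (simp add: g_def)
    have 1: "ln (\<tau> / s) = L * g \<tau>" using L by (simp add: g_def)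
    have 2: "ln (t / \<tau>) = L * (1 - g \<tau>)"
      using L \<tau> assms by (simp add: g_def L_def ln_div field_simps)
    have "0 \<le> 1 - g \<tau>" using 2 L \<tau> assms by (metis divide_pos_pos ln_ge_zero less_imp_le less_divide_eq_1_pos less_trans linorder_not_le mult_pos_neg zero_le_mult_iff greaterThanLessThan_iff)
    then have "ln (\<tau> / s) powr (x - 1) * ln (t / \<tau>) powr (y - 1) =
       (L powr (x - 1) * L powr (y - 1)) * (g \<tau> powr (x - 1) * (1 - g \<tau>) powr (y - 1))"
      unfolding 1 2 using g L by (simp add: powr_mult)
    also have "L powr (x - 1) * L powr (y - 1) = L powr (x + y - 1) / L"
    proof -
      have "L powr (x + y - 1) = L powr ((x - 1) + (y - 1) + 1)" by (simp add: algebra_simps)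
      also have "\<dots> = L powr (x - 1) * L powr (y - 1) * L" using L by (simp only: powr_add powr_one)
      finally show ?thesis using L by simp
    qed
    finally show ?thesis by simp
  qed
  have "(\<integral>\<^sup>+\<tau>. ennreal (indicator {s<..<t} \<tau> * (ln (\<tau> / s) powr (x - 1) * ln (t / \<tau>) powr (y - 1) / \<tau>)) \<partial>lborel)
     = (\<integral>\<^sup>+\<tau>. ennreal (L powr (x + y - 1)) * (f (g \<tau>) * ennreal (1 / (\<tau> * L)) * indicator {s..t} \<tau>) \<partial>lborel)"
  proof (rule nn_integral_cong_AE)
    \<comment> \<open>The substitution rule uses the closed interval, the claim the open
      one.\<close>
    have "AE \<tau> in lborel. \<tau> \<noteq> s" "AE \<tau> in lborel. \<tau> \<noteq> t" by (rule AE_lborel_singleton)+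
    then show "AE \<tau> in lborel. ennreal (indicator {s<..<t} \<tau> * (ln (\<tau> / s) powr (x - 1) * ln (t / \<tau>) powr (y - 1) / \<tau>))
       = ennreal (L powr (x + y - 1)) * (f (g \<tau>) * ennreal (1 / (\<tau> * L)) * indicator {s..t} \<tau>)"
    proof eventually_elim
      case (elim \<tau>)
      show ?case
      proof (cases "\<tau> \<in> {s<..<t}")
        case True
        then have "0 < \<tau>" using assms by auto
        then show ?thesis using True L pt[OF True] by (simp add: f_def ennreal_mult[symmetric])
      next
        case False
        then show ?thesis using elim by (auto simp: indicator_def)
      qed
    qed
  qed
  also have "\<dots> = ennreal (L powr (x + y - 1)) * ennreal (Beta x y)"
    unfolding Beta_eq[symmetric] f_def g_def by (rule nn_integral_cmult) measurable
  also have "\<dots> = ennreal (L powr (x + y - 1) * Beta x y)" by (simp add: ennreal_mult')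
  finally show ?thesis by (simp add: L_def)
qed

subsection \<open>Inverting the Hadamard derivative\<close>

text \<open>The kernel of the semigroup identity for the Hadamard integrals: the \<open>\<tau>\<close>-integral is a Beta
  integral that does not depend on \<open>s\<close> and \<open>t\<close>.\<close>

definition hadamard_kernel :: "real \<Rightarrow> real \<Rightarrow> real \<Rightarrow> real \<Rightarrow> real \<Rightarrow> real" where
  "hadamard_kernel a \<alpha> t s \<tau> = indicator {a<..<t} \<tau> * indicator {a<..<\<tau>} s *
     (ln (t / \<tau>) powr (\<alpha> - 1) * ln (\<tau> / s) powr (- \<alpha>) / \<tau>)"

text \<open>The Beta parameters 1 - \<alpha> and \<alpha> add up to 1, so the power of
  \<open>ln (t / s)\<close> has exponent 0 and \<open>Beta (1 - \<alpha>) \<alpha>\<close> is the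
  product of the two Gamma values.\<close>

lemma hadamard_kernel_integral:
  assumes "0 < a" "0 < \<alpha>" "\<alpha> < 1"
  shows "integrable lborel (hadamard_kernel a \<alpha> t s)"
    and "(\<integral>\<tau>. hadamard_kernel a \<alpha> t s \<tau> \<partial>lborel) = indicator {a<..<t} s * (Gamma \<alpha> * Gamma (1 - \<alpha>))"
proof -
  have nn: "0 \<le> hadamard_kernel a \<alpha> t s \<tau>" for \<tau>
    using assms(1) by (auto simp: hadamard_kernel_def indicator_def)
  have [measurable]: "hadamard_kernel a \<alpha> t s \<in> borel_measurable borel"
  proof -
    have "hadamard_kernel a \<alpha> t s = (\<lambda>\<tau>. (if a < \<tau> \<and> \<tau> < t \<and> a < s \<and> s < \<tau> then
       ln (t / \<tau>) powr (\<alpha> - 1) * ln (\<tau> / s) powr (- \<alpha>) / \<tau> else 0))"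
      by (auto simp: hadamard_kernel_def indicator_def)
    also have "\<dots> \<in> borel_measurable borel" by measurable
    finally show ?thesis .
  qed
  have "0 \<le> Gamma \<alpha> * Gamma (1 - \<alpha>)" using assms by (simp add: Gamma_real_pos less_imp_le)
  have eq: "(\<integral>\<^sup>+\<tau>. ennreal (hadamard_kernel a \<alpha> t s \<tau>) \<partial>lborel) = ennreal (indicator {a<..<t} s * (Gamma \<alpha> * Gamma (1 - \<alpha>)))"
  proof (cases "s \<in> {a<..<t}")
    case True
    then have s: "0 < s" "s < t" using assms by auto
    have "hadamard_kernel a \<alpha> t s \<tau> =
        indicator {s<..<t} \<tau> * (ln (\<tau> / s) powr ((1 - \<alpha>) - 1) * ln (t / \<tau>) powr (\<alpha> - 1) / \<tau>)" for \<tau>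
      using True by (auto simp: hadamard_kernel_def indicator_def)
    then have "(\<integral>\<^sup>+\<tau>. ennreal (hadamard_kernel a \<alpha> t s \<tau>) \<partial>lborel)
        = ennreal (ln (t / s) powr ((1 - \<alpha>) + \<alpha> - 1) * Beta (1 - \<alpha>) \<alpha>)"
      using nn_integral_log_kernel[OF s, of "1 - \<alpha>" \<alpha>] assms by simp
    also have "ln (t / s) powr ((1 - \<alpha>) + \<alpha> - 1) * Beta (1 - \<alpha>) \<alpha> = Gamma \<alpha> * Gamma (1 - \<alpha>)"
      using s by (simp add: Beta_def)
    finally show ?thesis using True by simp
  next
    case False
    then have "hadamard_kernel a \<alpha> t s \<tau> = 0" for \<tau>
      by (auto simp: hadamard_kernel_def indicator_def)
    then show ?thesis using False by simp
  qed
  show "integrable lborel (hadamard_kernel a \<alpha> t s)"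
    by (rule integrableI_nonneg) (auto simp: nn eq)
  show "(\<integral>\<tau>. hadamard_kernel a \<alpha> t s \<tau> \<partial>lborel) = indicator {a<..<t} s * (Gamma \<alpha> * Gamma (1 - \<alpha>))"
    using \<open>0 \<le> Gamma \<alpha> * Gamma (1 - \<alpha>)\<close>
    by (subst integral_eq_nn_integral) (auto simp: nn eq)
qed

text \<open>Here \<open>g\<close> stands for u': the factor \<open>s\<close> in the Hadamard
  derivative cancels ds / s. After Fubini the inner integral is the constant
  \<open>Gamma \<alpha> * Gamma (1 - \<alpha>)\<close> on (a, t), and one factor cancels the
  normalisation.\<close>

lemma hadamard_integral_inversion:
  fixes g :: "real \<Rightarrow> 'a::euclidean_space"
  assumes "0 < a" "0 < \<alpha>" "\<alpha> < 1" and g: "integrable lborel g"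
  shows "(LINT \<tau>:{a<..<t}|lborel. (ln (t / \<tau>) powr (\<alpha> - 1) / \<tau>) *\<^sub>R
      ((1 / Gamma (1 - \<alpha>)) *\<^sub>R (LINT s:{a<..<\<tau>}|lborel. ln (\<tau> / s) powr (- \<alpha>) *\<^sub>R g s)))
    = Gamma \<alpha> *\<^sub>R (LINT s:{a<..<t}|lborel. g s)"
proof -
  let ?k = "hadamard_kernel a \<alpha> t"
  have [measurable]: "g \<in> borel_measurable borel" using g by auto
  have G: "0 < Gamma \<alpha>" "0 < Gamma (1 - \<alpha>)" using assms by (simp_all add: Gamma_real_pos)
  have k_nn: "0 \<le> ?k s \<tau>" for s \<tau>
    using assms(1) by (auto simp: hadamard_kernel_def indicator_def)
  have k_meas: "case_prod ?k \<in> borel_measurable (borel \<Otimes>\<^sub>M borel)"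
  proof -
    have "case_prod ?k = (\<lambda>(s, \<tau>). (if a < \<tau> \<and> \<tau> < t \<and> a < s \<and> s < \<tau> then
       ln (t / \<tau>) powr (\<alpha> - 1) * ln (\<tau> / s) powr (- \<alpha>) / \<tau> else 0))"
      by (auto simp: hadamard_kernel_def indicator_def fun_eq_iff)
    also have "\<dots> \<in> borel_measurable (borel \<Otimes>\<^sub>M borel)" by measurable
    finally show ?thesis .
  qed
  have "integrable (lborel \<Otimes>\<^sub>M lborel) (\<lambda>(s, \<tau>). ?k s \<tau> *\<^sub>R g s)"
  proof (rule lborel_pair.Fubini_integrable)
    have "(\<lambda>x. case_prod ?k x *\<^sub>R g (fst x)) \<in> borel_measurable (borel \<Otimes>\<^sub>M borel)"
      using k_meas by measurable
    then show "(\<lambda>(s, \<tau>). ?k s \<tau> *\<^sub>R g s) \<in> borel_measurable (lborel \<Otimes>\<^sub>M lborel)"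
      by (simp add: case_prod_beta' cong: measurable_cong_sets sets_pair_measure_cong)
    \<comment> \<open>The kernel is nonnegative, so the norm falls on \<open>g s\<close> alone and
      the same Beta integral yields the integrable majorant required by Fubini.\<close>
    have "(\<integral>\<tau>. norm (case (s, \<tau>) of (s, \<tau>) \<Rightarrow> ?k s \<tau> *\<^sub>R g s) \<partial>lborel)
        = (Gamma \<alpha> * Gamma (1 - \<alpha>)) * (indicator {a<..<t} s *\<^sub>R norm (g s))" for s
      using hadamard_kernel_integral(2)[OF assms(1-3), of t s] by (simp add: k_nn)
    moreover have "integrable lborel (\<lambda>s. (Gamma \<alpha> * Gamma (1 - \<alpha>)) * (indicator {a<..<t} s *\<^sub>R norm (g s)))"
      by (intro integrable_mult_right integrable_mult_indicator integrable_norm g) simp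
    ultimately show "integrable lborel (\<lambda>s. \<integral>\<tau>. norm (case (s, \<tau>) of (s, \<tau>) \<Rightarrow> ?k s \<tau> *\<^sub>R g s) \<partial>lborel)"
      by presburger
    show "AE s in lborel. integrable lborel (\<lambda>\<tau>. case (s, \<tau>) of (s, \<tau>) \<Rightarrow> ?k s \<tau> *\<^sub>R g s)"
      using hadamard_kernel_integral(1)[OF assms(1-3)] by (auto intro: integrable_scaleR_left)
  qed
  then have "(\<integral>\<tau>. (\<integral>s. ?k s \<tau> *\<^sub>R g s \<partial>lborel) \<partial>lborel) = (\<integral>s. (\<integral>\<tau>. ?k s \<tau> *\<^sub>R g s \<partial>lborel) \<partial>lborel)"
    by (rule lborel_pair.Fubini_integral)
  also have "\<dots> = (\<integral>s. (Gamma \<alpha> * Gamma (1 - \<alpha>)) *\<^sub>R (indicator {a<..<t} s *\<^sub>R g s) \<partial>lborel)"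
    using hadamard_kernel_integral[OF assms(1-3), of t] by (simp add: mult.commute)
  also have "\<dots> = (Gamma \<alpha> * Gamma (1 - \<alpha>)) *\<^sub>R (LINT s:{a<..<t}|lborel. g s)"
    by (simp only: set_lebesgue_integral_def integral_scaleR_right)
  finally have swap: "(\<integral>\<tau>. (\<integral>s. ?k s \<tau> *\<^sub>R g s \<partial>lborel) \<partial>lborel) = (Gamma \<alpha> * Gamma (1 - \<alpha>)) *\<^sub>R (LINT s:{a<..<t}|lborel. g s)" .
  have inner: "(\<integral>s. ?k s \<tau> *\<^sub>R g s \<partial>lborel) = indicator {a<..<t} \<tau> *\<^sub>R ((ln (t / \<tau>) powr (\<alpha> - 1) / \<tau>) *\<^sub>R
     (LINT s:{a<..<\<tau>}|lborel. ln (\<tau> / s) powr (- \<alpha>) *\<^sub>R g s))" for \<tau>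
    unfolding set_lebesgue_integral_def integral_scaleR_right[symmetric]
    by (intro Bochner_Integration.integral_cong) (auto simp: hadamard_kernel_def indicator_def)
  have "(LINT \<tau>:{a<..<t}|lborel. (ln (t / \<tau>) powr (\<alpha> - 1) / \<tau>) *\<^sub>R
      ((1 / Gamma (1 - \<alpha>)) *\<^sub>R (LINT s:{a<..<\<tau>}|lborel. ln (\<tau> / s) powr (- \<alpha>) *\<^sub>R g s)))
    = (\<integral>\<tau>. (1 / Gamma (1 - \<alpha>)) *\<^sub>R (\<integral>s. ?k s \<tau> *\<^sub>R g s \<partial>lborel) \<partial>lborel)"
    unfolding inner set_lebesgue_integral_def[of _ "{a<..<t}"]
    by (intro Bochner_Integration.integral_cong refl) (simp add: mult_ac)
  also have "\<dots> = (1 / Gamma (1 - \<alpha>)) *\<^sub>R (\<integral>\<tau>. (\<integral>s. ?k s \<tau> *\<^sub>R g s \<partial>lborel) \<partial>lborel)"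
    by (rule integral_scaleR_right)
  finally show ?thesis using swap G by simp
qed

section \<open>The weight dx/x and the final estimate\<close>

lemma powr_integral_log_kernel:
  fixes a t c :: real
  assumes "0 < a" "a < t" "0 < y"
  shows "integrable lborel (\<lambda>\<tau>. indicator {a<..<t} \<tau> * (ln (t / \<tau>) powr (y - 1) / \<tau>))"
    and "(\<integral>\<tau>. indicator {a<..<t} \<tau> * (ln (t / \<tau>) powr (y - 1) / \<tau>) \<partial>lborel) = ln (t / a) powr y / y"
proof -
  have nn: "0 \<le> indicator {a<..<t} \<tau> * (ln (t / \<tau>) powr (y - 1) / \<tau>)" for \<tau>
    using assms(1) by (auto simp: indicator_def)
  have "Gamma (1 + y) = y * Gamma y"
    using assms(3) Gamma_plus1[of y] by (metis add.commute nonpos_Ints_nonpos not_less)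
  then have Beta1: "Beta 1 y = 1 / y"
    using Gamma_real_pos[OF assms(3)] by (simp add: Beta_def)
  \<comment> \<open>This is the logarithmic Beta integral with first parameter 1. The inserted power
    with exponent 0 equals 1 because \<open>ln (\<tau> / a)\<close> is nonzero inside the open
    interval; \<open>0 powr 0\<close> would be 0.\<close>
  have "(\<integral>\<^sup>+\<tau>. ennreal (indicator {a<..<t} \<tau> * (ln (t / \<tau>) powr (y - 1) / \<tau>)) \<partial>lborel)
     = (\<integral>\<^sup>+\<tau>. ennreal (indicator {a<..<t} \<tau> * (ln (\<tau> / a) powr (1 - 1) * ln (t / \<tau>) powr (y - 1) / \<tau>)) \<partial>lborel)"
    using assms by (intro nn_integral_cong) (auto simp: indicator_def)
  also have "\<dots> = ennreal (ln (t / a) powr (1 + y - 1) * Beta 1 y)"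
    by (rule nn_integral_log_kernel) (use assms in auto)
  finally have eq: "(\<integral>\<^sup>+\<tau>. ennreal (indicator {a<..<t} \<tau> * (ln (t / \<tau>) powr (y - 1) / \<tau>)) \<partial>lborel)
     = ennreal (ln (t / a) powr y / y)" by (simp add: Beta1)
  show "integrable lborel (\<lambda>\<tau>. indicator {a<..<t} \<tau> * (ln (t / \<tau>) powr (y - 1) / \<tau>))"
    by (rule integrableI_nonneg) (use nn eq in auto)
  have "(\<integral>\<tau>. indicator {a<..<t} \<tau> * (ln (t / \<tau>) powr (y - 1) / \<tau>) \<partial>lborel) = enn2real (ennreal (ln (t / a) powr y / y))"
    unfolding eq[symmetric] by (rule integral_eq_nn_integral) (use nn in auto)
  then show "(\<integral>\<tau>. indicator {a<..<t} \<tau> * (ln (t / \<tau>) powr (y - 1) / \<tau>) \<partial>lborel) = ln (t / a) powr y / y"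
    using assms(3) by simp
qed

text \<open>The bridge between the two measure-theoretic settings: \<open>f\<close> is measurable
  only for the completed measure, and its Borel representative \<open>h\<close> carries the integral
  over to \<open>lborel\<close>.\<close>

lemma dx_over_x_integral:
  fixes f :: "real \<Rightarrow> real"
  assumes "0 < a" and f: "f \<in> borel_measurable (lebesgue_on {a<..<b})"
    and h[measurable]: "h \<in> borel_measurable borel" and eq: "AE x in lborel. x \<in> {a<..<b} \<longrightarrow> f x = h x"
  shows "integrable (dx_over_x a b) f \<longleftrightarrow> integrable lborel (\<lambda>x. indicator {a<..<b} x * (h x / x))"
    and "integral\<^sup>L (dx_over_x a b) f = (\<integral>x. indicator {a<..<b} x * (h x / x) \<partial>lborel)"
proof -
  have meas: "(\<lambda>x. 1 / x) \<in> borel_measurable (lebesgue_on {a<..<b})"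
    by (intro measurable_restrict_space1 measurable_completion) measurable
  have nn: "AE x in lebesgue_on {a<..<b}. 0 \<le> 1 / x"
    using assms(1) by (auto simp: AE_restrict_space_iff)
  have m1: "(\<lambda>x. indicator {a<..<b} x *\<^sub>R ((1 / x) *\<^sub>R f x)) \<in> borel_measurable lebesgue"
    by (rule borel_measurable_restrict_space_iff[THEN iffD1, OF _ borel_measurable_scaleR[OF meas f]]) simp
  have m2: "(\<lambda>x. indicator {a<..<b} x * (h x / x)) \<in> borel_measurable lborel" by measurable
  have eq': "AE x in lebesgue. indicator {a<..<b} x *\<^sub>R ((1 / x) *\<^sub>R f x) = indicator {a<..<b} x * (h x / x)"
    using AE_completion[OF eq] by eventually_elim (auto simp: indicator_def)
  have "integrable (dx_over_x a b) f \<longleftrightarrow> integrable lebesgue (\<lambda>x. indicator {a<..<b} x *\<^sub>R ((1 / x) *\<^sub>R f x))"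
    unfolding dx_over_x_def using f meas nn by (simp add: integrable_density integrable_restrict_space)
  also have "\<dots> \<longleftrightarrow> integrable lebesgue (\<lambda>x. indicator {a<..<b} x * (h x / x))"
    by (rule integrable_cong_AE[OF m1 measurable_completion[OF m2] eq'])
  also have "\<dots> \<longleftrightarrow> integrable lborel (\<lambda>x. indicator {a<..<b} x * (h x / x))"
    by (rule integrable_completion[OF m2])
  finally show "integrable (dx_over_x a b) f \<longleftrightarrow> integrable lborel (\<lambda>x. indicator {a<..<b} x * (h x / x))" .
  have "integral\<^sup>L (dx_over_x a b) f = integral\<^sup>L lebesgue (\<lambda>x. indicator {a<..<b} x *\<^sub>R ((1 / x) *\<^sub>R f x))"
    unfolding dx_over_x_def using f meas nn by (simp add: integral_density integral_restrict_space)
  also have "\<dots> = integral\<^sup>L lebesgue (\<lambda>x. indicator {a<..<b} x * (h x / x))"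
    by (rule integral_cong_AE[OF m1 measurable_completion[OF m2] eq'])
  also have "\<dots> = (\<integral>x. indicator {a<..<b} x * (h x / x) \<partial>lborel)"
    by (rule integral_completion[OF m2])
  finally show "integral\<^sup>L (dx_over_x a b) f = (\<integral>x. indicator {a<..<b} x * (h x / x) \<partial>lborel)" .
qed

text \<open>Provides a Borel version \<open>v\<close> of the derivative from which \<open>u\<close>
  is recovered. For order 1 it is \<open>\<tau> *\<^sub>R g \<tau>\<close>, and the recovery is the
  fundamental theorem itself; below 1 it is the fractional integral of \<open>g\<close>.\<close>

lemma hadamard_deriv_representation:
  fixes u :: "real \<Rightarrow> 'a::euclidean_space"
  assumes "0 < a" "a < b" "0 < \<alpha>" "\<alpha> \<le> 1" and ac: "abs_cont_on a b u" and "u a = 0"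
  obtains v where "v \<in> borel_measurable borel"
    and "AE \<tau> in lborel. \<tau> \<in> {a<..<b} \<longrightarrow> hadamard_deriv a \<alpha> u \<tau> = v \<tau>"
    and "\<And>t. t \<in> {a<..<b} \<Longrightarrow>
      (LINT \<tau>:{a<..<t}|lborel. (ln (t / \<tau>) powr (\<alpha> - 1) / \<tau>) *\<^sub>R v \<tau>) = Gamma \<alpha> *\<^sub>R u t"
proof -
  obtain g where g: "integrable lborel g" and rep: "\<And>t. t \<in> {a..b} \<Longrightarrow> u t - u a = (LINT x:{a..t}|lborel. g x)"
    and deriv: "AE x in lborel. x \<in> {a<..<b} \<longrightarrow> (u has_vector_derivative g x) (at x)"
    by (rule abs_cont_integral_representation[OF \<open>a < b\<close> ac]) (rule that)
  have [measurable]: "g \<in> borel_measurable borel" using g by auto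
  have vd: "AE x in lborel. x \<in> {a<..<b} \<longrightarrow> vector_derivative u (at x) = g x"
    using deriv by eventually_elim (auto intro: vector_derivative_at)
  have u_eq: "u t = (LINT x:{a<..<t}|lborel. g x)" if "t \<in> {a<..<b}" for t
  proof -
    have "(LINT x:{a..t}|lborel. g x) = (LINT x:{a<..<t}|lborel. g x)"
      unfolding set_lebesgue_integral_def
    proof (rule integral_cong_AE)
      have "AE x in lborel. x \<noteq> a" "AE x in lborel. x \<noteq> t" by (rule AE_lborel_singleton)+
      then show "AE x in lborel. indicator {a..t} x *\<^sub>R g x = indicator {a<..<t} x *\<^sub>R g x"
        by eventually_elim (auto simp: indicator_def)
    qed auto
    then show ?thesis using rep[of t] that \<open>u a = 0\<close> by simp
  qed
  show thesis
  proof (cases "\<alpha> = 1")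
    case True
    show thesis
    proof (rule that[of "\<lambda>\<tau>. \<tau> *\<^sub>R g \<tau>"])
      show "AE \<tau> in lborel. \<tau> \<in> {a<..<b} \<longrightarrow> hadamard_deriv a \<alpha> u \<tau> = \<tau> *\<^sub>R g \<tau>"
        using vd by eventually_elim (simp add: hadamard_deriv_def True)
      fix t assume t: "t \<in> {a<..<b}"
      have "(LINT \<tau>:{a<..<t}|lborel. (ln (t / \<tau>) powr (\<alpha> - 1) / \<tau>) *\<^sub>R \<tau> *\<^sub>R g \<tau>) = (LINT \<tau>:{a<..<t}|lborel. g \<tau>)"
        unfolding set_lebesgue_integral_def using \<open>0 < a\<close>
        by (intro Bochner_Integration.integral_cong refl) (auto simp: indicator_def True)
      then show "(LINT \<tau>:{a<..<t}|lborel. (ln (t / \<tau>) powr (\<alpha> - 1) / \<tau>) *\<^sub>R \<tau> *\<^sub>R g \<tau>) = Gamma \<alpha> *\<^sub>R u t"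
        using u_eq[OF t] True by simp
    qed measurable
  next
    case False
    then have "\<alpha> < 1" using \<open>\<alpha> \<le> 1\<close> by simp
    define v where "v \<tau> = (1 / Gamma (1 - \<alpha>)) *\<^sub>R (LINT s:{a<..<\<tau>}|lborel. ln (\<tau> / s) powr (- \<alpha>) *\<^sub>R g s)" for \<tau>
    show thesis
    proof (rule that[of v])
      have "v = (\<lambda>\<tau>. (1 / Gamma (1 - \<alpha>)) *\<^sub>R
          (\<integral>s. (if a < s \<and> s < \<tau> then ln (\<tau> / s) powr (- \<alpha>) else 0) *\<^sub>R g s \<partial>lborel))"
        unfolding v_def set_lebesgue_integral_def fun_eq_iff
        by (intro allI arg_cong[where f = "scaleR (1 / Gamma (1 - \<alpha>))"] Bochner_Integration.integral_cong) (auto simp: indicator_def)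
      also have "\<dots> \<in> borel_measurable borel" by measurable
      finally show "v \<in> borel_measurable borel" .
      \<comment> \<open>For order below 1 equality holds at every point of (a, b), since the
        integral ignores the null set on which u' and \<open>g\<close> differ. Measurability of the
        integrand \<open>?h\<close> comes from completeness: it agrees almost everywhere with the
        Borel function \<open>?f\<close>.\<close>
      have "hadamard_deriv a \<alpha> u \<tau> = v \<tau>" if \<tau>: "\<tau> \<in> {a<..<b}" for \<tau>
      proof -
        let ?f = "\<lambda>s. indicator {a<..<\<tau>} s *\<^sub>R (ln (\<tau> / s) powr (- \<alpha>) *\<^sub>R g s)"
        let ?h = "\<lambda>s. indicator {a<..<\<tau>} s *\<^sub>R ((ln (\<tau> / s) powr (- \<alpha>) / s) *\<^sub>R (s *\<^sub>R vector_derivative u (at s)))"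
        have f: "?f \<in> borel_measurable lborel" by measurable
        have eq: "AE s in lebesgue. ?f s = ?h s"
          using AE_completion[OF vd]
          by eventually_elim (use \<tau> \<open>0 < a\<close> in \<open>auto simp: indicator_def\<close>)
        have "integral\<^sup>L lebesgue ?h = integral\<^sup>L lebesgue ?f"
          by (rule integral_cong_AE[OF _ _ AE_symmetric[OF eq]])
             (rule borel_measurable_AE[OF _ eq] measurable_completion[OF f])+
        also have "\<dots> = integral\<^sup>L lborel ?f" by (rule integral_completion[OF f])
        finally show ?thesis
          using False by (simp add: hadamard_deriv_def v_def set_lebesgue_integral_def)
      qed
      then show "AE \<tau> in lborel. \<tau> \<in> {a<..<b} \<longrightarrow> hadamard_deriv a \<alpha> u \<tau> = v \<tau>" by simp
      show "(LINT \<tau>:{a<..<t}|lborel. (ln (t / \<tau>) powr (\<alpha> - 1) / \<tau>) *\<^sub>R v \<tau>) = Gamma \<alpha> *\<^sub>R u t"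
        if "t \<in> {a<..<b}" for t
        unfolding v_def using hadamard_integral_inversion[OF \<open>0 < a\<close> \<open>0 < \<alpha>\<close> \<open>\<alpha> < 1\<close> g] u_eq[OF that] by simp
    qed
  qed
qed

text \<open>Hoelder is applied with respect to dx/x on all of (a, b). The cutoff at \<open>t\<close>
  sits in the kernel, so the norm of the derivative over the full interval appears directly.\<close>

theorem hadamard_pointwise_bound:
  fixes u :: "real \<Rightarrow> 'a::euclidean_space"
  assumes "0 < a" "a < b" "1 < p" "1 / p < \<alpha>" "\<alpha> \<le> 1" and ac: "abs_cont_on a b u" and "u a = 0"
    and Lp: "in_Lp (dx_over_x a b) p (hadamard_deriv a \<alpha> u)" and t: "t \<in> {a<..<b}"
  shows "norm (u t) \<le> ln (t / a) powr (\<alpha> - 1 / p)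
      / ((\<alpha> * p / (p - 1) - 1 / (p - 1)) powr ((p - 1) / p) * Gamma \<alpha>)
      * Lp_norm (dx_over_x a b) p (hadamard_deriv a \<alpha> u)"
proof -
  let ?M = "dx_over_x a b" and ?D = "hadamard_deriv a \<alpha> u"
  define q where "q = p / (p - 1)"
  have q: "1 < q" "1 / q + 1 / p = 1" "1 / q = (p - 1) / p" using \<open>1 < p\<close> by (auto simp: q_def field_simps)
  \<comment> \<open>The base in the denominator of the bound. It is positive exactly because
    \<alpha> p > 1, and \<open>y - 1\<close> is the exponent of the kernel raised to the power
    \<open>q\<close>.\<close>
  define y where "y = \<alpha> * p / (p - 1) - 1 / (p - 1)"
  have "(\<alpha> - 1) * q + 1 = ((\<alpha> - 1) * p + (p - 1)) / (p - 1)"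
    using \<open>1 < p\<close> by (simp add: q_def add_divide_distrib)
  also have "\<dots> = y" by (simp add: y_def diff_divide_distrib[symmetric] algebra_simps)
  finally have y_q: "y = (\<alpha> - 1) * q + 1" ..
  have y_eq: "y = (\<alpha> * p - 1) / (p - 1)" by (simp add: y_def diff_divide_distrib)
  have "1 < \<alpha> * p" using assms(3,4) by (simp add: field_simps)
  then have y_pos: "0 < y" using \<open>1 < p\<close> by (simp add: y_eq)
  have "y * (1 / q) = (\<alpha> * p - 1) / p" using \<open>1 < p\<close> by (simp add: y_eq q(3))
  also have "\<dots> = \<alpha> - 1 / p" using \<open>1 < p\<close> by (simp add: diff_divide_distrib)
  finally have y_exp: "y * (1 / q) = \<alpha> - 1 / p" .
  have "0 < 1 / p" using \<open>1 < p\<close> by simp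
  then have "0 < \<alpha>" using assms(4) by linarith
  have tb: "a < t" "t < b" using t by auto
  obtain v where [measurable]: "v \<in> borel_measurable borel"
    and Dv: "AE \<tau> in lborel. \<tau> \<in> {a<..<b} \<longrightarrow> ?D \<tau> = v \<tau>"
    and rep: "\<And>t. t \<in> {a<..<b} \<Longrightarrow>
      (LINT \<tau>:{a<..<t}|lborel. (ln (t / \<tau>) powr (\<alpha> - 1) / \<tau>) *\<^sub>R v \<tau>) = Gamma \<alpha> *\<^sub>R u t"
    by (rule hadamard_deriv_representation[OF assms(1,2) \<open>0 < \<alpha>\<close> assms(5) ac \<open>u a = 0\<close>]) (rule that)
  \<comment> \<open>The factor 1 / \<tau> of the kernel is left out: it belongs to the measure and
    must not be raised to the power \<open>q\<close>.\<close>
  define w where "w \<tau> = indicator {a<..<t} \<tau> * ln (t / \<tau>) powr (\<alpha> - 1)" for \<tau> :: real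
  have [measurable]: "w \<in> borel_measurable borel" unfolding w_def by measurable
  have sets_M: "borel_measurable ?M = borel_measurable (lebesgue_on {a<..<b})"
    by (intro measurable_cong_sets) (simp_all add: dx_over_x_def)
  have w_M: "f \<in> borel_measurable (lebesgue_on {a<..<b})" if "f \<in> borel_measurable borel" for f :: "real \<Rightarrow> real"
    using that by (intro measurable_restrict_space1 measurable_completion) simp
  have D_M: "(\<lambda>\<tau>. norm (?D \<tau>)) \<in> borel_measurable (lebesgue_on {a<..<b})"
    by (rule measurable_compose[OF _ borel_measurable_norm]) (use Lp in \<open>simp add: in_Lp_def sets_M\<close>)
  have wq: "\<bar>w \<tau>\<bar> powr q = indicator {a<..<t} \<tau> * ln (t / \<tau>) powr (y - 1)" for \<tau>
    using q(1) by (auto simp: w_def indicator_def powr_powr y_q)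
  have wq_eq: "indicator {a<..<b} \<tau> * (\<bar>w \<tau>\<bar> powr q / \<tau>) = indicator {a<..<t} \<tau> * (ln (t / \<tau>) powr (y - 1) / \<tau>)" for \<tau>
    unfolding wq using tb by (auto simp: indicator_def)
  have wq_meas: "(\<lambda>\<tau>. \<bar>w \<tau>\<bar> powr q) \<in> borel_measurable borel" by measurable
  note dx = dx_over_x_integral[OF \<open>0 < a\<close> w_M[OF wq_meas] wq_meas AE_I2[OF impI[OF refl]]]
  have wq_int: "integrable ?M (\<lambda>\<tau>. \<bar>w \<tau>\<bar> powr q)" "(\<integral>\<tau>. \<bar>w \<tau>\<bar> powr q \<partial>?M) = ln (t / a) powr y / y"
    unfolding dx wq_eq by (rule powr_integral_log_kernel[OF \<open>0 < a\<close> \<open>a < t\<close> y_pos])+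
  have "Gamma \<alpha> * norm (u t) = norm (LINT \<tau>:{a<..<t}|lborel. (ln (t / \<tau>) powr (\<alpha> - 1) / \<tau>) *\<^sub>R v \<tau>)"
    unfolding rep[OF t] using Gamma_real_pos[OF \<open>0 < \<alpha>\<close>] by simp
  also have "\<dots> \<le> (\<integral>\<tau>. norm (indicator {a<..<t} \<tau> *\<^sub>R ((ln (t / \<tau>) powr (\<alpha> - 1) / \<tau>) *\<^sub>R v \<tau>)) \<partial>lborel)"
    unfolding set_lebesgue_integral_def by (rule integral_norm_bound)
  also have "\<dots> = (\<integral>\<tau>. indicator {a<..<b} \<tau> * (\<bar>w \<tau> * norm (v \<tau>)\<bar> / \<tau>) \<partial>lborel)"
    using tb \<open>0 < a\<close> by (intro Bochner_Integration.integral_cong refl) (auto simp: w_def indicator_def abs_mult)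
  also have "\<dots> = (\<integral>\<tau>. \<bar>w \<tau> * norm (?D \<tau>)\<bar> \<partial>?M)"
  proof (rule dx_over_x_integral(2)[symmetric, OF \<open>0 < a\<close>])
    show "(\<lambda>\<tau>. \<bar>w \<tau> * norm (?D \<tau>)\<bar>) \<in> borel_measurable (lebesgue_on {a<..<b})"
      by (intro borel_measurable_abs borel_measurable_times D_M w_M) measurable
    show "AE \<tau> in lborel. \<tau> \<in> {a<..<b} \<longrightarrow> \<bar>w \<tau> * norm (?D \<tau>)\<bar> = \<bar>w \<tau> * norm (v \<tau>)\<bar>"
      using Dv by eventually_elim simp
  qed measurable
  also have "\<dots> \<le> (\<integral>\<tau>. \<bar>w \<tau>\<bar> powr q \<partial>?M) powr (1 / q) * (\<integral>\<tau>. \<bar>norm (?D \<tau>)\<bar> powr p \<partial>?M) powr (1 / p)"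
    using Lp D_M wq_int(1) w_M[of w] q \<open>1 < p\<close>
    by (intro Holder_inequality(2)) (auto simp: in_Lp_def sets_M)
  also have "\<dots> = (ln (t / a) powr y / y) powr (1 / q) * Lp_norm ?M p ?D"
    by (simp add: wq_int(2) Lp_norm_def)
  also have "(ln (t / a) powr y / y) powr (1 / q) = ln (t / a) powr (\<alpha> - 1 / p) / y powr ((p - 1) / p)"
    using y_pos y_exp q(3) by (simp add: powr_divide powr_powr)
  finally have "Gamma \<alpha> * norm (u t) \<le> ln (t / a) powr (\<alpha> - 1 / p) / y powr ((p - 1) / p) * Lp_norm ?M p ?D" .
  then have "norm (u t) \<le> ln (t / a) powr (\<alpha> - 1 / p) / y powr ((p - 1) / p) * Lp_norm ?M p ?D / Gamma \<alpha>"
    by (simp only: pos_le_divide_eq[OF Gamma_real_pos[OF \<open>0 < \<alpha>\<close>]] mult.commute[of _ "Gamma \<alpha>"])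
  then show ?thesis unfolding y_def[symmetric] by (simp add: mult_ac)
qed

text \<open>Both \<open>real\<close> and \<open>complex\<close> are instances of the sort of
  \<open>'a\<close>. The pointwise bound holds at every \<open>t\<close> in (a, b), so the essential
  supremum only requires a bound uniform in \<open>t\<close>.\<close>

theorem theorem5p4:
  fixes a b p \<alpha> :: real
    and u :: "real \<Rightarrow> 'a::{real_normed_field, euclidean_space}"
  assumes "0 < a" and "a < b"
    and "1 < p" and "1 / p < \<alpha>" and "\<alpha> \<le> 1"
    and "abs_cont_on a b u"
    and "in_Lp (lebesgue_on {a<..<b}) p u"
    and "u a = 0"
    and "in_Lp (dx_over_x a b) p (hadamard_deriv a \<alpha> u)"
  shows "Linfty_norm (lebesgue_on {a<..<b}) u \<le>
    ereal (\<bar>ln (b / a)\<bar> powr (\<alpha> - 1 / p)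
      / ((\<alpha> * p / (p - 1) - 1 / (p - 1)) powr ((p - 1) / p) * Gamma \<alpha>)
      * Lp_norm (dx_over_x a b) p (hadamard_deriv a \<alpha> u))"
  unfolding Linfty_norm_def
proof (rule esssup_I)
  have "u \<in> borel_measurable (lebesgue_on {a<..<b})"
    using assms(7) by (simp add: in_Lp_def)
  then show "(\<lambda>x. ereal (norm (u x))) \<in> borel_measurable (lebesgue_on {a<..<b})"
    by measurable
  have "0 < 1 / p" using \<open>1 < p\<close> by simp
  then have G: "0 < Gamma \<alpha>" using assms(4) by (intro Gamma_real_pos) linarith
  have "norm (u t) \<le> \<bar>ln (b / a)\<bar> powr (\<alpha> - 1 / p)
      / ((\<alpha> * p / (p - 1) - 1 / (p - 1)) powr ((p - 1) / p) * Gamma \<alpha>)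
      * Lp_norm (dx_over_x a b) p (hadamard_deriv a \<alpha> u)" if t: "t \<in> {a<..<b}" for t
  proof (rule order_trans[OF hadamard_pointwise_bound[OF assms(1-6,8,9) t]])
    have "0 \<le> ln (t / a)" "ln (t / a) \<le> \<bar>ln (b / a)\<bar>"
      using t assms(1) by (auto simp: ln_div)
    \<comment> \<open>The exponent \<alpha> - 1 / p is positive, so the bound grows with
      \<open>t\<close> and is largest in the limit \<open>b\<close>.\<close>
    then have "ln (t / a) powr (\<alpha> - 1 / p) \<le> \<bar>ln (b / a)\<bar> powr (\<alpha> - 1 / p)"
      using assms(4) by (intro powr_mono2) auto
    then show "ln (t / a) powr (\<alpha> - 1 / p)
        / ((\<alpha> * p / (p - 1) - 1 / (p - 1)) powr ((p - 1) / p) * Gamma \<alpha>)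
        * Lp_norm (dx_over_x a b) p (hadamard_deriv a \<alpha> u)
      \<le> \<bar>ln (b / a)\<bar> powr (\<alpha> - 1 / p)
        / ((\<alpha> * p / (p - 1) - 1 / (p - 1)) powr ((p - 1) / p) * Gamma \<alpha>)
        * Lp_norm (dx_over_x a b) p (hadamard_deriv a \<alpha> u)"
      using G by (intro mult_right_mono divide_right_mono) (auto simp: Lp_norm_def)
  qed
  then show "AE x in lebesgue_on {a<..<b}. ereal (norm (u x)) \<le>
    ereal (\<bar>ln (b / a)\<bar> powr (\<alpha> - 1 / p)
      / ((\<alpha> * p / (p - 1) - 1 / (p - 1)) powr ((p - 1) / p) * Gamma \<alpha>)
      * Lp_norm (dx_over_x a b) p (hadamard_deriv a \<alpha> u))"
    by (intro AE_I2) simp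
qed

end
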